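(* Let $k$ and $s$ be nonnegative integers and let $G$ be a balanced bipartite graph with $|V(G)|=2n\ge 8k(k+1)$ and $\delta(G)\ge k\ge\max\{s,1\}$. If either $\rho(G)\ge\rho(F^0_{n,k,s})$ or $\mu(G)\ge\mu(F^0_{n,k,s})$, then $\mathscr{B}_{n+s}(G)=K_{n,n}$ unless $G\in\{F_{n,k,s},\,F^0_{n,k,s}\}$.
   Context: Graphs are finite, simple and undirected; equality of graphs is up to isomorphism. A bipartite graph $G=[U,V]$ is balanced if $|U|=|V|$. $\delta(G)$ is the minimum degree, $\rho(G)$ is the largest eigenvalue of the adjacency matrix $A(G)$, and $\mu(G)$ is the largest eigenvalue of $A(G)+D(G)$, where $D(G)$ is the diagonal degree matrix. For an integer $\ell>0$ and a bipartite graph $G=[U,V]$, the bipartite closure $\mathscr{B}_\ell(G)$ is the bipartite graph obtained from $G$ by recursively joining pairs of nonadjacent vertices $u\in U$, $v\in V$ whose degree sum (in the current graph) is at least $\ell$ until no such pair remains nonadjacent. For integers $n>k\ge 0$, $a\ge k+1$, $b\ge1$, let $(X,Y)$ be the bipartition of $K_{n,a+b}$ with $|X|=n$, $|Y|=a+b$, let $X_1\subset X$ with $|X_1|=n-k$ and $Y_1\subset Y$ with $|Y_1|=b$. Then $Z_{a,b}$ (depending also on $n,k$) is the graph obtained from $K_{n,a+b}$ by deleting all edges between $X_1$ and $Y_1$, and $Z^0_{a,b}=Z_{a,b}-e$, where $e=uv$ is an edge of $Z_{a,b}$ with $u\in Y\setminus Y_1$ (so $d(u)=n$) and $v\in X_1$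 (so $d(v)=a$). Define $F_{n,k,s}=Z_{n+s-k-1,\,k+1-s}$ and $F^0_{n,k,s}=Z^0_{n+s-k-1,\,k+1-s}$. *)

theory Defs
  imports "Graph_Theory.Graph_Theory" "Jordan_Normal_Form.Char_Poly"
begin

text \<open>
  Finite simple undirected graphs are the \<^locale>\<open>pair_graph\<close>s of \<open>Graph_Theory\<close>: finite,
  loop-free and with a symmetric arc relation, so that the edge \<open>uv\<close> is the pair of arcs
  \<open>(u,v)\<close>, \<open>(v,u)\<close>, and the degree of a vertex is its \<^const>\<open>out_degree\<close>.
\<close>

definition bipartite_graph :: "'a set \<Rightarrow> 'a set \<Rightarrow> 'a pair_pre_digraph \<Rightarrow> bool" where
  "bipartite_graph U V G \<longleftrightarrow> pair_graph G \<and> pverts G = U \<union> V \<and> U \<inter> V = {}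
     \<and> parcs G \<subseteq> U \<times> V \<union> V \<times> U"

definition degree_of :: "'a pair_pre_digraph \<Rightarrow> 'a \<Rightarrow> nat" where
  "degree_of G v = out_degree (with_proj G) v"

definition min_degree :: "'a pair_pre_digraph \<Rightarrow> nat" where
  "min_degree G = Min (degree_of G ` pverts G)"

definition add_edge :: "'a \<Rightarrow> 'a \<Rightarrow> 'a pair_pre_digraph \<Rightarrow> 'a pair_pre_digraph" where
  "add_edge u v G = G\<lparr>parcs := parcs G \<union> {(u, v), (v, u)}\<rparr>"

definition del_edge :: "'a \<Rightarrow> 'a \<Rightarrow> 'a pair_pre_digraph \<Rightarrow> 'a pair_pre_digraph" where
  "del_edge u v G = G\<lparr>parcs := parcs G - {(u, v), (v, u)}\<rparr>"


section \<open>Spectral radius and signless Laplacian spectral radius\<close>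

text \<open>
  Matrices are indexed by numbers, so the vertices are numbered by some arbitrary bijection. The
  eigenvalues do not depend on it, see \<open>eigenvalue_vert_matrix\<close> below. Both matrices are real
  symmetric, so that their real eigenvalues are all their eigenvalues.
\<close>

definition vert_enum :: "'a pair_pre_digraph \<Rightarrow> nat \<Rightarrow> 'a" where
  "vert_enum G = (SOME f. bij_betw f {0..<card (pverts G)} (pverts G))"

definition adj_matrix :: "'a pair_pre_digraph \<Rightarrow> real mat" where
  "adj_matrix G = mat (card (pverts G)) (card (pverts G))
     (\<lambda>(i, j). if (vert_enum G i, vert_enum G j) \<in> parcs G then 1 else 0)"

definition deg_matrix :: "'a pair_pre_digraph \<Rightarrow> real mat" where
  "deg_matrix G = mat (card (pverts G)) (card (pverts G))
     (\<lambda>(i, j). if i = j then real (degree_of G (vert_enum G i)) else 0)"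

definition rho :: "'a pair_pre_digraph \<Rightarrow> real" where
  "rho G = Max {x. eigenvalue (adj_matrix G) x}"

definition mu :: "'a pair_pre_digraph \<Rightarrow> real" where
  "mu G = Max {x. eigenvalue (adj_matrix G + deg_matrix G) x}"

lemma bij_betw_vert_enum:
  assumes "finite (pverts G)"
  shows "bij_betw (vert_enum G) {0..<card (pverts G)} (pverts G)"
  unfolding vert_enum_def using ex_bij_betw_nat_finite[OF assms] by (rule someI_ex)

lemma eigenvalue_vert_matrix:
  fixes M :: "'a \<Rightarrow> 'a \<Rightarrow> real"
  assumes f: "bij_betw f {0..<N} S"
  shows "eigenvalue (mat N N (\<lambda>(i, j). M (f i) (f j))) x \<longleftrightarrow>
    (\<exists>h. (\<exists>v\<in>S. h v \<noteq> 0) \<and> (\<forall>v\<in>S. (\<Sum>w\<in>S. M v w * h w) = x * h v))"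
    (is "eigenvalue ?A x \<longleftrightarrow> (\<exists>h. ?P h)")
proof
  assume "eigenvalue ?A x"
  then obtain y where y: "y \<in> carrier_vec N" "y \<noteq> 0\<^sub>v N" "?A *\<^sub>v y = x \<cdot>\<^sub>v y"
    unfolding eigenvalue_def eigenvector_def by auto
  let ?g = "the_inv_into {0..<N} f"
  let ?h = "\<lambda>v. y $ ?g v"
  have gf: "?g (f i) = i" if "i < N" for i
    using f that by (simp add: bij_betw_def the_inv_into_f_f)
  have S: "S = f ` {0..<N}" using f by (simp add: bij_betw_def)
  have inj: "inj_on f {0..<N}" using f by (simp add: bij_betw_def)
  have "\<exists>i<N. y $ i \<noteq> 0"
    using y(1,2) by (metis carrier_vecD eq_vecI index_zero_vec(1,2))
  then have 1: "\<exists>v\<in>S. ?h v \<noteq> 0" using gf unfolding S by auto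
  have 2: "(\<Sum>w\<in>S. M (f i) w * ?h w) = x * ?h (f i)" if i: "i < N" for i
  proof -
    have "(\<Sum>w\<in>S. M (f i) w * ?h w) = (\<Sum>j\<in>{0..<N}. M (f i) (f j) * y $ j)"
      unfolding S by (simp add: sum.reindex[OF inj] gf)
    also have "\<dots> = (?A *\<^sub>v y) $ i"
      using i y(1) by (simp add: scalar_prod_def)
    also have "\<dots> = x * ?h (f i)" using y(1,3) i gf by simp
    finally show ?thesis .
  qed
  show "\<exists>h. ?P h"
    using 1 2 unfolding S by (intro exI[of _ ?h]) auto
next
  assume "\<exists>h. ?P h"
  then obtain h where h: "?P h" by blast
  have S: "S = f ` {0..<N}" using f by (simp add: bij_betw_def)
  have inj: "inj_on f {0..<N}" using f by (simp add: bij_betw_def)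
  define y where "y = vec N (\<lambda>i. h (f i))"
  have "?A *\<^sub>v y = x \<cdot>\<^sub>v y"
  proof (rule eq_vecI)
    fix i assume "i < dim_vec (x \<cdot>\<^sub>v y)"
    then have i: "i < N" by (simp add: y_def)
    have "(?A *\<^sub>v y) $ i = (\<Sum>j\<in>{0..<N}. M (f i) (f j) * h (f j))"
      using i by (simp add: y_def scalar_prod_def)
    also have "\<dots> = (\<Sum>w\<in>S. M (f i) w * h w)"
      unfolding S by (simp add: sum.reindex[OF inj])
    also have "\<dots> = x * h (f i)" using h i S by auto
    finally show "(?A *\<^sub>v y) $ i = (x \<cdot>\<^sub>v y) $ i" using i by (simp add: y_def)
  qed (simp add: y_def)
  moreover have "y \<noteq> 0\<^sub>v N"
  proof
    assume "y = 0\<^sub>v N"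
    then have "h (f i) = 0" if "i < N" for i
      using that unfolding y_def by (metis index_vec index_zero_vec(1))
    then show False using h S by auto
  qed
  moreover have "y \<in> carrier_vec N" by (simp add: y_def)
  ultimately show "eigenvalue ?A x"
    unfolding eigenvalue_def eigenvector_def by (intro exI[of _ y]) simp
qed


section \<open>The bipartite closure\<close>

text \<open>
  One step joins one admissible pair, with the degrees taken in the current graph.
\<close>

definition closure_step ::
    "'a set \<Rightarrow> 'a set \<Rightarrow> nat \<Rightarrow> 'a pair_pre_digraph \<Rightarrow> 'a pair_pre_digraph \<Rightarrow> bool" where
  "closure_step U V l G H \<longleftrightarrow> (\<exists>u\<in>U. \<exists>v\<in>V. (u, v) \<notin> parcs G
     \<and> degree_of G u + degree_of G v \<ge> l \<and> H = add_edge u v G)"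

definition is_bipartite_closure ::
    "'a set \<Rightarrow> 'a set \<Rightarrow> nat \<Rightarrow> 'a pair_pre_digraph \<Rightarrow> 'a pair_pre_digraph \<Rightarrow> bool" where
  "is_bipartite_closure U V l G H \<longleftrightarrow>
     (closure_step U V l)\<^sup>*\<^sup>* G H \<and> (\<nexists>H'. closure_step U V l H H')"

text \<open>The result exists and does not depend on the order of the steps: \<open>ex1_bipartite_closure\<close>.\<close>

definition bipartite_closure ::
    "'a set \<Rightarrow> 'a set \<Rightarrow> nat \<Rightarrow> 'a pair_pre_digraph \<Rightarrow> 'a pair_pre_digraph" where
  "bipartite_closure U V l G = (THE H. is_bipartite_closure U V l G H)"

lemma degree_of_eq_card: "degree_of G v = card {w. (v, w) \<in> parcs G}"
proof -
  have "out_arcs (with_proj G) v = Pair v ` {w. (v, w) \<in> parcs G}"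
    by (auto simp: out_arcs_def)
  then show ?thesis
    by (simp add: degree_of_def out_degree_def card_image inj_on_def)
qed

lemma bipartite_graph_add_edge:
  assumes "bipartite_graph U V G" "u \<in> U" "v \<in> V"
  shows "bipartite_graph U V (add_edge u v G)"
proof -
  interpret pair_graph G using assms(1) by (simp add: bipartite_graph_def)
  have uv: "pverts G = U \<union> V" "U \<inter> V = {}" "parcs G \<subseteq> U \<times> V \<union> V \<times> U"
    using assms(1) by (auto simp: bipartite_graph_def)
  have fin: "finite U" "finite V" using pair_finite_verts uv(1) by auto
  have sym: "sym (parcs G)" using sym_arcs by (simp add: symmetric_def)
  have sym': "sym (parcs G \<union> {(u, v), (v, u)})"
    using sym by (auto simp: sym_def)
  have "pair_graph (add_edge u v G)"
    by unfold_locales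
      (use assms uv sym' fin in \<open>auto simp: add_edge_def symmetric_def dest: in_arcsD1 in_arcsD2 pair_no_loops\<close>)
  then show ?thesis using assms uv by (auto simp: bipartite_graph_def add_edge_def)
qed

lemma closure_steps_invariant:
  assumes "(closure_step U V l)\<^sup>*\<^sup>* G H" "bipartite_graph U V G"
  shows "bipartite_graph U V H \<and> parcs G \<subseteq> parcs H \<and> pverts H = pverts G"
  using assms
proof (induction rule: rtranclp_induct)
  case (step H H')
  then show ?case
    using bipartite_graph_add_edge[of U V H]
    by (auto simp: closure_step_def add_edge_def)
qed simp

lemma closure_steps_subset:
  assumes "(closure_step U V l)\<^sup>*\<^sup>* G H" "bipartite_graph U V G"
    and K: "is_bipartite_closure U V l G K"
  shows "parcs H \<subseteq> parcs K"
  using assms(1)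
proof (induction rule: rtranclp_induct)
  case base
  show ?case
    using closure_steps_invariant[OF _ assms(2)] K unfolding is_bipartite_closure_def by blast
next
  case (step H H')
  have bK: "bipartite_graph U V K"
    using closure_steps_invariant[OF _ assms(2)] K unfolding is_bipartite_closure_def by blast
  interpret K: pair_graph K using bK by (simp add: bipartite_graph_def)
  have sym: "sym (parcs K)" using K.sym_arcs by (simp add: symmetric_def)
  obtain u v where uv: "u \<in> U" "v \<in> V" "degree_of H u + degree_of H v \<ge> l" "H' = add_edge u v H"
    using step.hyps(2) by (auto simp: closure_step_def)
  have "degree_of H w \<le> degree_of K w" for w
  proof -
    have "{w'. (w, w') \<in> parcs K} \<subseteq> pverts K" using K.in_arcsD2 by blast
    then have "finite {w'. (w, w') \<in> parcs K}" using K.pair_finite_verts by (rule finite_subset)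
    then show ?thesis unfolding degree_of_eq_card using step.IH by (intro card_mono) auto
  qed
  then have "degree_of K u + degree_of K v \<ge> l" using uv(3) by (meson add_mono le_trans)
  then have "(u, v) \<in> parcs K"
    using K uv(1,2) unfolding is_bipartite_closure_def closure_step_def by blast
  then have "(v, u) \<in> parcs K" using sym by (simp add: sym_def)
  then show ?case using \<open>(u, v) \<in> parcs K\<close> uv(4) step.IH by (auto simp: add_edge_def)
qed

lemma ex1_bipartite_closure:
  assumes G: "bipartite_graph U V G"
  shows "\<exists>!H. is_bipartite_closure U V l G H"
proof (rule ex_ex1I)
  show "\<exists>H. is_bipartite_closure U V l G H"
    using G
  proof (induction "card (U \<times> V - parcs G)" arbitrary: G rule: less_induct)
    case less
    show ?case
    proof (cases "\<exists>H. closure_step U V l G H")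
      case True
      then obtain u v where uv: "u \<in> U" "v \<in> V" "(u, v) \<notin> parcs G"
        "closure_step U V l G (add_edge u v G)"
        by (auto simp: closure_step_def)
      interpret pair_graph G using less.prems by (simp add: bipartite_graph_def)
      have fin: "finite (U \<times> V)"
        using less.prems pair_finite_verts by (auto simp: bipartite_graph_def)
      have "card (U \<times> V - parcs (add_edge u v G)) < card (U \<times> V - parcs G)"
        by (rule psubset_card_mono) (use fin uv in \<open>auto simp: add_edge_def\<close>)
      from less.hyps[OF this bipartite_graph_add_edge[OF less.prems uv(1,2)]]
      show ?thesis
        using uv(4) unfolding is_bipartite_closure_def
        by (meson converse_rtranclp_into_rtranclp)
    qed (auto simp: is_bipartite_closure_def)
  qed
next
  fix H K assume H: "is_bipartite_closure U V l G H" and K: "is_bipartite_closure U V l G K"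
  have "parcs H = parcs K"
    using closure_steps_subset[OF _ G] H K unfolding is_bipartite_closure_def
    by (meson subset_antisym)
  moreover have "pverts H = pverts K"
    using closure_steps_invariant[OF _ G] H K unfolding is_bipartite_closure_def by metis
  ultimately show "H = K" by simp
qed

section \<open>The graphs \<open>Z\<close>, \<open>Z\<^sup>0\<close>, \<open>F\<close>, \<open>F\<^sup>0\<close>\<close>

text \<open>
  Here \<open>X\<close>, \<open>X\<^sub>1\<close>, \<open>Y\<close>, \<open>Y\<^sub>1\<close> are the first \<open>n\<close>, \<open>n - k\<close> vertices \<open>Inl i\<close> and the first \<open>a + b\<close>, \<open>b\<close>
  vertices \<open>Inr j\<close>, for \<open>n > k\<close>, \<open>a > k\<close>, \<open>b > 0\<close>.
\<close>

definition Z_graph :: "nat \<Rightarrow> nat \<Rightarrow> nat \<Rightarrow> nat \<Rightarrow> (nat + nat) pair_pre_digraph" where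
  "Z_graph n k a b =
     (let X = Inl ` {..<n}; Y = Inr ` {..<a + b}; X1 = Inl ` {..<n - k}; Y1 = Inr ` {..<b}
      in \<lparr>pverts = X \<union> Y, parcs = (X \<times> Y \<union> Y \<times> X) - (X1 \<times> Y1 \<union> Y1 \<times> X1)\<rparr>)"

text \<open>
  All edges between \<open>X\<^sub>1\<close> and \<open>Y - Y\<^sub>1\<close> are equivalent under automorphisms; the one joining
  \<open>Inl 0\<close> and \<open>Inr b\<close> is deleted.
\<close>

definition Z0_graph :: "nat \<Rightarrow> nat \<Rightarrow> nat \<Rightarrow> nat \<Rightarrow> (nat + nat) pair_pre_digraph" where
  "Z0_graph n k a b = del_edge (Inr b) (Inl 0) (Z_graph n k a b)"

text \<open>The subtractions are not truncated when \<open>s \<le> k < n\<close>.\<close>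

definition F_graph :: "nat \<Rightarrow> nat \<Rightarrow> nat \<Rightarrow> (nat + nat) pair_pre_digraph" where
  "F_graph n k s = Z_graph n k (n + s - k - 1) (k + 1 - s)"

definition F0_graph :: "nat \<Rightarrow> nat \<Rightarrow> nat \<Rightarrow> (nat + nat) pair_pre_digraph" where
  "F0_graph n k s = Z0_graph n k (n + s - k - 1) (k + 1 - s)"

end

theory Submission
  imports Defs "HOL-Analysis.Function_Topology" "HOL-Analysis.Convex"
begin

text \<open>
  Write \<open>m = n - k\<close>, \<open>r = k + 1 - s\<close> and \<open>a = n - r\<close>. The graph \<open>F\<close> is \<open>K\<^bsub>n,n\<^esub>\<close> without the edges
  of a rectangle \<open>L \<times> T\<close>, where \<open>L\<close> and \<open>T\<close> lie on different sides and have \<open>r\<close> and \<open>m\<close> vertices,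
  and \<open>F\<^sup>0\<close> lacks one more edge, which joins a vertex outside \<open>L\<close> to one of \<open>T\<close>. The theorem holds for
  three reasons.

  A large radius forces many edges. A bipartite graph with \<open>e\<close> edges and \<open>n\<close> vertices on each side
  satisfies \<open>\<rho>\<^sup>2 \<le> e\<close> and \<open>\<mu> \<le> n + e / n\<close> (\<open>adj_radius_sq_le_edges\<close>, \<open>signless_radius_le_edges\<close>), with
  equality for \<open>K\<^bsub>a,n\<^esub>\<close> completed by isolated vertices. As \<open>F\<^sup>0\<close> contains all but one edge of
  a \<open>K\<^bsub>a,n\<^esub>\<close>, a test vector gives \<open>\<rho>(F\<^sup>0)\<^sup>2 > a n - 2\<close> and \<open>n (\<mu>(F\<^sup>0) - n) > a n - 2\<close>. Either hypothesis
  on \<open>G\<close> therefore yields more than \<open>a n - 2\<close> edges, that is, fewer than \<open>n r + 2\<close> nonedges, and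
  \<open>n \<ge> 4 k (k + 1)\<close> makes \<open>n r + 2 \<le> (m - 1) (r + 1)\<close> (\<open>few_nonedges\<close>).

  A closed graph with few nonedges is \<open>K\<^bsub>n,n\<^esub>\<close> or \<open>F\<close>. In the closure every vertex of a nonedge lies in
  at most \<open>m\<close> nonedges, and the two ends of a nonedge lie together in at least \<open>m + r\<close>, counted with
  multiplicity. Fewer than \<open>(m - 1) (r + 1)\<close> nonedges then leave no other shape than an \<open>r\<close> by \<open>m\<close>
  rectangle, or none at all (\<open>nonedges_rectangle\<close>).

  So if the closure of \<open>G\<close> is not complete, then \<open>G\<close> is a spanning subgraph of \<open>F\<close>, and by the minimum
  degree it contains all edges of \<open>F\<close> at \<open>L\<close>. If it is neither \<open>F\<close> nor \<open>F\<^sup>0\<close>, then it is a proper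
  subgraph of a copy of \<open>F\<^sup>0\<close>, or it lacks an edge between the vertices outside \<open>L\<close> and outside \<open>T\<close>; in
  the second case shifting edges towards the larger entry of a Perron vector turns it into a subgraph
  of some \<open>F\<^sup>0\<close> without decreasing the quadratic form. In both cases the radius of \<open>G\<close> is strictly
  smaller than that of \<open>F\<^sup>0\<close> (\<open>gen_radius_less_F0\<close>).

  The adjacency matrix \<open>A\<close> and the signless Laplacian \<open>A + D\<close> are the cases \<open>c = 0\<close> and \<open>c = 1\<close> of
  \<open>A + c D\<close>. The last argument is carried out once, for all \<open>c \<ge> 0\<close>.
\<close>

section \<open>Extremal vectors of a quadratic form on a finite set\<close>

definition quad_form :: "('a \<Rightarrow> 'a \<Rightarrow> real) \<Rightarrow> 'a set \<Rightarrow> ('a \<Rightarrow> real) \<Rightarrow> real" where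
  "quad_form M S h = (\<Sum>v\<in>S. h v * (\<Sum>w\<in>S. M v w * h w))"

lemma quad_form_add:
  assumes sym: "\<And>v w. v \<in> S \<Longrightarrow> w \<in> S \<Longrightarrow> M v w = M w v"
  shows "quad_form M S (\<lambda>v. g v + t * h v)
    = quad_form M S g + 2 * t * (\<Sum>v\<in>S. h v * (\<Sum>w\<in>S. M v w * g w)) + t\<^sup>2 * quad_form M S h"
proof -
  define R where "R f v = (\<Sum>w\<in>S. M v w * f w)" for f v
  have R: "R (\<lambda>v. g v + t * h v) v = R g v + t * R h v" for v
    unfolding R_def by (simp add: algebra_simps sum.distrib sum_distrib_left)
  have "(\<Sum>v\<in>S. g v * R h v) = (\<Sum>v\<in>S. \<Sum>w\<in>S. g v * (M v w * h w))"
    by (simp add: R_def sum_distrib_left)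
  also have "\<dots> = (\<Sum>w\<in>S. \<Sum>v\<in>S. g v * (M v w * h w))"
    by (rule sum.swap)
  also have "\<dots> = (\<Sum>v\<in>S. h v * R g v)"
    by (auto simp: R_def sum_distrib_left sym intro!: sum.cong)
  finally have swap: "(\<Sum>v\<in>S. g v * R h v) = (\<Sum>v\<in>S. h v * R g v)" .
  have "quad_form M S (\<lambda>v. g v + t * h v)
    = (\<Sum>v\<in>S. g v * R g v + t * (g v * R h v) + t * (h v * R g v) + t\<^sup>2 * (h v * R h v))"
    unfolding quad_form_def R_def[symmetric] R
    by (intro sum.cong refl) (simp add: algebra_simps power2_eq_square)
  also have "\<dots> = (\<Sum>v\<in>S. g v * R g v) + 2 * t * (\<Sum>v\<in>S. h v * R g v) + t\<^sup>2 * (\<Sum>v\<in>S. h v * R h v)"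
    by (simp add: sum.distrib swap flip: sum_distrib_left)
  finally show ?thesis unfolding quad_form_def R_def[symmetric] .
qed

text \<open>
  Moving from \<open>g\<close> by \<open>t\<close> times the image \<open>b\<close> of \<open>g\<close> changes the form by \<open>2 t \<parallel>b\<parallel>\<^sup>2 + O(t\<^sup>2)\<close>; it would
  become negative for a small negative \<open>t\<close> if \<open>b\<close> were not zero.
\<close>

lemma psd_form_zero_kernel:
  assumes fin: "finite S" and sym: "\<And>v w. v \<in> S \<Longrightarrow> w \<in> S \<Longrightarrow> M v w = M w v"
    and psd: "\<And>h. quad_form M S h \<ge> 0" and zero: "quad_form M S g = 0" and v: "v \<in> S"
  shows "(\<Sum>w\<in>S. M v w * g w) = 0"
proof -
  define b where "b v = (\<Sum>w\<in>S. M v w * g w)" for v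
  define q where "q = quad_form M S b"
  define s where "s = (\<Sum>v\<in>S. b v * b v)"
  have le: "0 \<le> 2 * t * s + t\<^sup>2 * q" for t
    using psd[of "\<lambda>v. g v + t * b v"] quad_form_add[of S M g t b, OF sym] zero
    unfolding b_def[symmetric] s_def q_def by simp
  have s0: "s \<ge> 0" unfolding s_def by (intro sum_nonneg) simp
  have "s = 0"
  proof (rule ccontr)
    assume "s \<noteq> 0"
    then have s: "s > 0" using s0 by simp
    \<comment> \<open>\<open>2 t s + t\<^sup>2 q\<close> need not have a minimum, but \<open>2 t s + t\<^sup>2 (\<bar>q\<bar> + 1)\<close> bounds it and is least here\<close>
    define t where "t = - s / (\<bar>q\<bar> + 1)"
    have "0 \<le> 2 * t * s + t\<^sup>2 * q" by (rule le)
    also have "\<dots> \<le> 2 * t * s + t\<^sup>2 * (\<bar>q\<bar> + 1)"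
      by (intro add_left_mono mult_left_mono) auto
    also have "\<dots> = - (s\<^sup>2 / (\<bar>q\<bar> + 1))"
    proof -
      have "2 * t * s + t\<^sup>2 * p = - (s\<^sup>2 / p)" if "t = - s / p" "p > 0" for p :: real
        using that(2) unfolding that(1) by (simp add: power2_eq_square field_simps)
      then show ?thesis by (simp add: t_def)
    qed
    also have "\<dots> < 0" using s by (simp add: add_nonneg_pos)
    finally show False by simp
  qed
  then have "b v * b v = 0" using v fin unfolding s_def by (simp add: sum_nonneg_eq_0_iff)
  then show ?thesis by (simp add: b_def)
qed

text \<open>
  The unit sphere of the functions that vanish outside \<open>S\<close> is compact in the product topology, so the
  form has a maximum on it; homogeneity extends the bound to all functions.
\<close>

lemma max_quad_form_attained:
  assumes fin: "finite S" and ne: "S \<noteq> {}"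
  obtains g where "(\<Sum>v\<in>S. (g v)\<^sup>2) = 1"
    "\<And>h. quad_form M S h \<le> quad_form M S g * (\<Sum>v\<in>S. (h v)\<^sup>2)"
proof -
  define B :: "('a \<Rightarrow> real) set" where "B = Pi\<^sub>E UNIV (\<lambda>v. if v \<in> S then {-1..1} else {0})"
  define K where "K = B \<inter> {h. (\<Sum>v\<in>S. (h v)\<^sup>2) = 1}"
  have contS: "continuous_on UNIV (\<lambda>h :: 'a \<Rightarrow> real. \<Sum>v\<in>S. (h v)\<^sup>2)"
    by (intro continuous_intros continuous_on_product_coordinates)
  have "compactin (product_topology (\<lambda>i. euclidean) UNIV) B"
    unfolding B_def by (subst compactin_PiE) auto
  then have "compact B"
    by (simp add: euclidean_product_topology)
  moreover have "closed {h :: 'a \<Rightarrow> real. (\<Sum>v\<in>S. (h v)\<^sup>2) = 1}"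
    by (intro closed_Collect_eq contS continuous_on_const)
  ultimately have "compact K" unfolding K_def by (rule compact_Int_closed)
  moreover obtain u where u: "u \<in> S" using ne by blast
  have "(\<lambda>v. if v = u then 1 else 0) \<in> K"
  proof -
    have "(\<Sum>v\<in>S. (if v = u then 1 else 0 :: real)\<^sup>2) = (\<Sum>v\<in>S. if v = u then 1 else 0)"
      by (intro sum.cong) auto
    then show ?thesis using u fin unfolding K_def B_def by auto
  qed
  then have "K \<noteq> {}" by blast
  moreover have "continuous_on K (quad_form M S)"
    unfolding quad_form_def
    by (rule continuous_on_subset[OF _ subset_UNIV])
       (intro continuous_intros continuous_on_product_coordinates)
  ultimately obtain g where g: "g \<in> K" "\<forall>h\<in>K. quad_form M S h \<le> quad_form M S g"
    using continuous_attains_sup by metis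
  have "quad_form M S h \<le> quad_form M S g * (\<Sum>v\<in>S. (h v)\<^sup>2)" for h
  proof (cases "(\<Sum>v\<in>S. (h v)\<^sup>2) = 0")
    case True
    then have "\<forall>v\<in>S. h v = 0" using fin by (simp add: sum_nonneg_eq_0_iff)
    then have "quad_form M S h = 0" by (simp add: quad_form_def)
    then show ?thesis using True by simp
  next
    case False
    define c where "c = sqrt (\<Sum>v\<in>S. (h v)\<^sup>2)"
    have c2: "c\<^sup>2 = (\<Sum>v\<in>S. (h v)\<^sup>2)" unfolding c_def by (simp add: sum_nonneg)
    have c: "c > 0" using False unfolding c_def
      by (metis less_eq_real_def real_sqrt_gt_zero sum_nonneg zero_le_power2)
    define h' where "h' v = (if v \<in> S then h v / c else 0)" for v
    have n1: "(\<Sum>v\<in>S. (h' v)\<^sup>2) = 1"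
      using c c2 False by (simp add: h'_def power_divide flip: sum_divide_distrib)
    have "h' v \<in> {-1..1}" if "v \<in> S" for v
    proof -
      have "(h' v)\<^sup>2 \<le> 1" using member_le_sum[OF that, of "\<lambda>v. (h' v)\<^sup>2"] fin n1 by simp
      then show ?thesis by (simp add: abs_square_le_1 abs_le_iff)
    qed
    then have "h' \<in> K" using n1 unfolding K_def B_def by (auto split: if_splits simp: h'_def simp del: atLeastAtMost_iff)
    then have "quad_form M S h' \<le> quad_form M S g" using g by blast
    moreover have "quad_form M S h' = quad_form M S h / c\<^sup>2"
      unfolding quad_form_def h'_def
      by (simp add: sum_divide_distrib power2_eq_square field_simps sum_distrib_left)
    ultimately show ?thesis using c unfolding c2[symmetric]
      by (simp add: field_simps)
  qed
  then show thesis using that g(1) unfolding K_def by blast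
qed

text \<open>
  If \<open>x\<close> bounds the Rayleigh quotient, then \<open>x I - M\<close> is positive semidefinite, so a vector attaining
  the bound is in its kernel.
\<close>

lemma quad_form_extremal_eigenvector:
  assumes fin: "finite S" and sym: "\<And>v w. v \<in> S \<Longrightarrow> w \<in> S \<Longrightarrow> M v w = M w v"
    and bound: "\<And>h. quad_form M S h \<le> x * (\<Sum>v\<in>S. (h v)\<^sup>2)"
    and eq: "quad_form M S g = x * (\<Sum>v\<in>S. (g v)\<^sup>2)" and v: "v \<in> S"
  shows "(\<Sum>w\<in>S. M v w * g w) = x * g v"
proof -
  define M' where "M' v w = (if v = w then x else 0) - M v w" for v w
  have row: "(\<Sum>w\<in>S. M' v w * h w) = x * h v - (\<Sum>w\<in>S. M v w * h w)" if "v \<in> S" for v h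
  proof -
    have "(\<Sum>w\<in>S. (if v = w then x else 0) * h w) = (\<Sum>w\<in>S. if v = w then x * h w else 0)"
      by (intro sum.cong) auto
    also have "\<dots> = x * h v" using fin that by simp
    finally show ?thesis
      unfolding M'_def by (simp add: left_diff_distrib sum_subtractf)
  qed
  have form: "quad_form M' S h = x * (\<Sum>v\<in>S. (h v)\<^sup>2) - quad_form M S h" for h
    unfolding quad_form_def
    by (simp add: row right_diff_distrib sum_subtractf sum_distrib_left power2_eq_square mult.left_commute)
  have sym': "M' v w = M' w v" if "v \<in> S" "w \<in> S" for v w
    using sym[OF that] by (simp add: M'_def)
  have "(\<Sum>w\<in>S. M' v w * g w) = 0"
    by (rule psd_form_zero_kernel[OF fin sym' _ _ v]) (use form bound eq in auto)
  then show ?thesis using row[OF v, of g] by simp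
qed

section \<open>The spectrum of \<open>A(G) + c D(G)\<close>\<close>

text \<open>
  This is the matrix \<open>A(G) + c D(G)\<close> acting on functions on the vertices: each neighbour of \<open>v\<close>
  contributes one term \<open>c h(v)\<close>, which adds up to \<open>c\<close> times the degree.
\<close>

definition gen_adj :: "real \<Rightarrow> 'a pair_pre_digraph \<Rightarrow> ('a \<Rightarrow> real) \<Rightarrow> 'a \<Rightarrow> real" where
  "gen_adj c G h v = (\<Sum>w | (v, w) \<in> parcs G. h w + c * h v)"

definition gen_eigenvector :: "real \<Rightarrow> 'a pair_pre_digraph \<Rightarrow> real \<Rightarrow> ('a \<Rightarrow> real) \<Rightarrow> bool" where
  "gen_eigenvector c G x h \<longleftrightarrow>
     (\<exists>v\<in>pverts G. h v \<noteq> 0) \<and> (\<forall>v\<in>pverts G. gen_adj c G h v = x * h v)"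

definition gen_radius :: "real \<Rightarrow> 'a pair_pre_digraph \<Rightarrow> real" where
  "gen_radius c G = Max {x. \<exists>h. gen_eigenvector c G x h}"

definition gen_form :: "real \<Rightarrow> 'a pair_pre_digraph \<Rightarrow> ('a \<Rightarrow> real) \<Rightarrow> real" where
  "gen_form c G h = (\<Sum>v\<in>pverts G. h v * gen_adj c G h v)"

definition gen_entry :: "real \<Rightarrow> 'a pair_pre_digraph \<Rightarrow> 'a \<Rightarrow> 'a \<Rightarrow> real" where
  "gen_entry c G v w = (if (v, w) \<in> parcs G then 1 else 0)
     + (if v = w then c * real (degree_of G v) else 0)"

lemma gen_entry_row:
  assumes G: "pair_graph G" and v: "v \<in> pverts G"
  shows "(\<Sum>w\<in>pverts G. gen_entry c G v w * h w) = gen_adj c G h v"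
proof -
  interpret pair_graph G by (rule G)
  have nb: "{w. (v, w) \<in> parcs G} = {w \<in> pverts G. (v, w) \<in> parcs G}"
    using in_arcsD2 by blast
  have "(\<Sum>w\<in>pverts G. gen_entry c G v w * h w)
    = (\<Sum>w\<in>pverts G. if (v, w) \<in> parcs G then h w else 0)
      + (\<Sum>w\<in>pverts G. if v = w then c * real (degree_of G v) * h w else 0)"
    unfolding gen_entry_def by (subst sum.distrib[symmetric]) (intro sum.cong, auto simp: algebra_simps)
  also have "\<dots> = (\<Sum>w | (v, w) \<in> parcs G. h w) + c * real (degree_of G v) * h v"
    using v by (simp add: nb sum.inter_filter)
  also have "\<dots> = gen_adj c G h v"
    by (simp add: gen_adj_def sum.distrib degree_of_eq_card)
  finally show ?thesis .
qed

lemma gen_entry_sym: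
  assumes "pair_graph G"
  shows "gen_entry c G v w = gen_entry c G w v"
proof -
  interpret pair_graph G by (rule assms)
  show ?thesis unfolding gen_entry_def using arcs_symmetric by auto
qed

lemma quad_form_gen_entry:
  assumes "pair_graph G"
  shows "quad_form (gen_entry c G) (pverts G) h = gen_form c G h"
  unfolding quad_form_def gen_form_def by (simp add: gen_entry_row[OF assms])

lemma eigenvalue_gen_entry:
  assumes G: "pair_graph G"
  shows "eigenvalue (mat (card (pverts G)) (card (pverts G))
      (\<lambda>(i, j). gen_entry c G (vert_enum G i) (vert_enum G j))) x
    \<longleftrightarrow> (\<exists>h. gen_eigenvector c G x h)"
proof -
  interpret pair_graph G by (rule G)
  show ?thesis
    unfolding eigenvalue_vert_matrix[OF bij_betw_vert_enum[OF pair_finite_verts]] gen_eigenvector_def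
    by (simp add: gen_entry_row[OF G] cong: conj_cong ball_cong)
qed

lemma rho_eq_gen_radius:
  assumes G: "pair_graph G"
  shows "rho G = gen_radius 0 G"
proof -
  have "adj_matrix G = mat (card (pverts G)) (card (pverts G))
      (\<lambda>(i, j). gen_entry 0 G (vert_enum G i) (vert_enum G j))"
    by (rule eq_matI) (auto simp: adj_matrix_def gen_entry_def)
  then show ?thesis by (simp add: rho_def gen_radius_def eigenvalue_gen_entry[OF G])
qed

lemma mu_eq_gen_radius:
  assumes G: "pair_graph G"
  shows "mu G = gen_radius 1 G"
proof -
  interpret pair_graph G by (rule G)
  have inj: "inj_on (vert_enum G) {0..<card (pverts G)}"
    using bij_betw_vert_enum[OF pair_finite_verts] by (simp add: bij_betw_def)
  have "adj_matrix G + deg_matrix G = mat (card (pverts G)) (card (pverts G))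
      (\<lambda>(i, j). gen_entry 1 G (vert_enum G i) (vert_enum G j))"
    using inj by (intro eq_matI) (auto simp: adj_matrix_def deg_matrix_def gen_entry_def inj_on_eq_iff)
  then show ?thesis by (simp add: mu_def gen_radius_def eigenvalue_gen_entry[OF G])
qed

lemma finite_gen_eigenvalues:
  assumes G: "pair_graph G"
  shows "finite {x. \<exists>h. gen_eigenvector c G x h}"
proof -
  define A where "A = mat (card (pverts G)) (card (pverts G))
      (\<lambda>(i, j). gen_entry c G (vert_enum G i) (vert_enum G j))"
  have A: "A \<in> carrier_mat (card (pverts G)) (card (pverts G))" by (simp add: A_def)
  have "char_poly A \<noteq> 0" using degree_monic_char_poly[OF A] by auto
  then have "finite {x. poly (char_poly A) x = 0}" by (rule poly_roots_finite)
  moreover have "{x. \<exists>h. gen_eigenvector c G x h} = {x. poly (char_poly A) x = 0}"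
    using eigenvalue_gen_entry[OF G] eigenvalue_root_char_poly[OF A] unfolding A_def by simp
  ultimately show ?thesis by simp
qed

lemma gen_eigenvector_form:
  assumes "gen_eigenvector c G x h"
  shows "gen_form c G h = x * (\<Sum>v\<in>pverts G. (h v)\<^sup>2)"
  using assms unfolding gen_form_def gen_eigenvector_def
  by (simp add: sum_distrib_left power2_eq_square mult.left_commute)

text \<open>
  The maximum of the quadratic form on the unit sphere is an eigenvalue, and no eigenvalue exceeds it.
  Hence the radius is the maximum of the Rayleigh quotient. This variational description is the form
  in which the radius is used from here on.
\<close>

lemma gen_radius_attained:
  assumes G: "pair_graph G" and ne: "pverts G \<noteq> {}"
  shows gen_form_le_radius: "gen_form c G h \<le> gen_radius c G * (\<Sum>v\<in>pverts G. (h v)\<^sup>2)"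
    and ex_gen_eigenvector_radius: "\<exists>h. gen_eigenvector c G (gen_radius c G) h"
proof -
  interpret pair_graph G by (rule G)
  note form = quad_form_gen_entry[OF G]
  obtain g where g: "(\<Sum>v\<in>pverts G. (g v)\<^sup>2) = 1"
    and max: "gen_form c G h \<le> gen_form c G g * (\<Sum>v\<in>pverts G. (h v)\<^sup>2)" for h
    using max_quad_form_attained[OF pair_finite_verts ne, of "gen_entry c G"] unfolding form by metis
  let ?x = "gen_form c G g"
  have "\<exists>v\<in>pverts G. g v \<noteq> 0"
  proof (rule ccontr)
    assume "\<not> ?thesis"
    then have "(\<Sum>v\<in>pverts G. (g v)\<^sup>2) = 0" by (intro sum.neutral) auto
    then show False using g by simp
  qed
  moreover have "gen_adj c G g v = ?x * g v" if "v \<in> pverts G" for v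
    using quad_form_extremal_eigenvector[where M = "gen_entry c G" and S = "pverts G" and x = ?x,
        OF pair_finite_verts gen_entry_sym[OF G], of g v] max g that
    unfolding form by (simp add: gen_entry_row[OF G])
  ultimately have eig: "gen_eigenvector c G ?x g" by (simp add: gen_eigenvector_def)
  have "x \<le> ?x" if "gen_eigenvector c G x h" for x h
  proof -
    have "gen_form c G h = x * (\<Sum>v\<in>pverts G. (h v)\<^sup>2)"
      by (rule gen_eigenvector_form[OF that])
    moreover have "(\<Sum>v\<in>pverts G. (h v)\<^sup>2) > 0"
      using that unfolding gen_eigenvector_def by (auto intro!: sum_pos2)
    ultimately show ?thesis using max[of h] by simp
  qed
  then have "gen_radius c G = ?x"
    unfolding gen_radius_def using eig finite_gen_eigenvalues[OF G]
    by (intro Max_eqI) auto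
  then show "gen_form c G h \<le> gen_radius c G * (\<Sum>v\<in>pverts G. (h v)\<^sup>2)"
    and "\<exists>h. gen_eigenvector c G (gen_radius c G) h"
    using max eig by auto
qed

lemma gen_form_extremal_eigenvector:
  assumes G: "pair_graph G" and nz: "\<exists>v\<in>pverts G. h v \<noteq> 0"
    and ge: "gen_radius c G * (\<Sum>v\<in>pverts G. (h v)\<^sup>2) \<le> gen_form c G h"
  shows "gen_eigenvector c G (gen_radius c G) h"
proof -
  interpret pair_graph G by (rule G)
  have ne: "pverts G \<noteq> {}" using nz by blast
  have "gen_adj c G h v = gen_radius c G * h v" if "v \<in> pverts G" for v
    using quad_form_extremal_eigenvector[where M = "gen_entry c G" and S = "pverts G" and x = "gen_radius c G",
        OF pair_finite_verts gen_entry_sym[OF G], of h v] gen_form_le_radius[OF G ne] ge that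
    unfolding quad_form_gen_entry[OF G] by (simp add: gen_entry_row[OF G] antisym)
  then show ?thesis using nz by (simp add: gen_eigenvector_def)
qed

text \<open>
  Replacing an extremal vector by its absolute value does not decrease the form, because the entries
  of \<open>A\<close> are nonnegative and the diagonal part sees only squares; so the absolute value is extremal too.
\<close>

lemma ex_nonneg_gen_eigenvector:
  assumes G: "pair_graph G" and ne: "pverts G \<noteq> {}"
  obtains h where "gen_eigenvector c G (gen_radius c G) h" "\<And>v. h v \<ge> 0"
proof -
  interpret pair_graph G by (rule G)
  obtain g where g: "gen_eigenvector c G (gen_radius c G) g"
    using ex_gen_eigenvector_radius[OF G ne] by blast
  have le: "g v * gen_adj c G g v \<le> \<bar>g v\<bar> * gen_adj c G (\<lambda>v. \<bar>g v\<bar>) v" for v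
  proof -
    have "g v * (g w + c * g v) \<le> \<bar>g v\<bar> * (\<bar>g w\<bar> + c * \<bar>g v\<bar>)" for w
    proof -
      have "g v * g w \<le> \<bar>g v\<bar> * \<bar>g w\<bar>" by (metis abs_ge_self abs_mult)
      moreover have "g v * (c * g v) = \<bar>g v\<bar> * (c * \<bar>g v\<bar>)"
        by (simp add: mult.left_commute)
      ultimately show ?thesis by (simp add: distrib_left)
    qed
    then show ?thesis unfolding gen_adj_def sum_distrib_left by (intro sum_mono)
  qed
  have "gen_form c G g \<le> gen_form c G (\<lambda>v. \<bar>g v\<bar>)"
    unfolding gen_form_def by (intro sum_mono le)
  then have "gen_radius c G * (\<Sum>v\<in>pverts G. \<bar>g v\<bar>\<^sup>2) \<le> gen_form c G (\<lambda>v. \<bar>g v\<bar>)"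
    using gen_eigenvector_form[OF g] by simp
  moreover have "\<exists>v\<in>pverts G. \<bar>g v\<bar> \<noteq> 0" using g by (auto simp: gen_eigenvector_def)
  ultimately have "gen_eigenvector c G (gen_radius c G) (\<lambda>v. \<bar>g v\<bar>)"
    by (intro gen_form_extremal_eigenvector[OF G]) auto
  then show thesis using that[of "\<lambda>v. \<bar>g v\<bar>"] by simp
qed

section \<open>Invariance under isomorphism\<close>

definition graph_map :: "('a \<Rightarrow> 'b) \<Rightarrow> 'a pair_pre_digraph \<Rightarrow> 'b pair_pre_digraph \<Rightarrow> bool" where
  "graph_map g G H \<longleftrightarrow> bij_betw g (pverts G) (pverts H)
     \<and> (\<forall>v\<in>pverts G. \<forall>w\<in>pverts G. (v, w) \<in> parcs G \<longleftrightarrow> (g v, g w) \<in> parcs H)"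

lemma graph_map_inv:
  assumes "graph_map g G H"
  shows "graph_map (the_inv_into (pverts G) g) H G"
proof -
  have bij: "bij_betw g (pverts G) (pverts H)" using assms by (simp add: graph_map_def)
  then have inj: "inj_on g (pverts G)" and im: "g ` pverts G = pverts H" by (auto simp: bij_betw_def)
  show ?thesis
    unfolding graph_map_def
  proof (intro conjI ballI)
    show "bij_betw (the_inv_into (pverts G) g) (pverts H) (pverts G)" by (rule bij_betw_the_inv_into[OF bij])
  next
    fix v w assume "v \<in> pverts H" "w \<in> pverts H"
    then obtain x y where "v = g x" "w = g y" "x \<in> pverts G" "y \<in> pverts G" using im by blast
    then show "(v, w) \<in> parcs H \<longleftrightarrow> (the_inv_into (pverts G) g v, the_inv_into (pverts G) g w) \<in> parcs G"
      using assms inj by (simp add: graph_map_def the_inv_into_f_f)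
  qed
qed

lemma graph_map_digraph_iso:
  assumes G: "pair_graph G" and H: "pair_graph H" and g: "graph_map g G H"
  shows "digraph_iso (with_proj G) (with_proj H)"
proof -
  interpret G: pair_graph G by (rule G)
  interpret H: pair_graph H by (rule H)
  let ?f = "\<lparr>iso_verts = g, iso_arcs = map_prod g g, iso_head = snd, iso_tail = fst\<rparr>"
  have inj: "inj_on g (pverts G)" and im: "g ` pverts G = pverts H"
    using g by (auto simp: graph_map_def bij_betw_def)
  have sub: "parcs G \<subseteq> pverts G \<times> pverts G" using G.in_arcsD1 G.in_arcsD2 by auto
  have "inj_on (map_prod g g) (parcs G)"
    by (rule inj_on_subset[OF map_prod_inj_on[OF inj inj] sub])
  then have iso: "pre_digraph.digraph_isomorphism (with_proj G) ?f"
    unfolding pre_digraph.digraph_isomorphism_def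
    using inj G.wf_digraph_axioms by auto
  have "map_prod g g ` parcs G = parcs H"
  proof (intro equalityI subsetI)
    fix e assume "e \<in> map_prod g g ` parcs G"
    then show "e \<in> parcs H" using g sub by (auto simp: graph_map_def)
  next
    fix e assume e: "e \<in> parcs H"
    then obtain v w where vw: "e = (g v, g w)" "v \<in> pverts G" "w \<in> pverts G"
      using H.in_arcsD1 H.in_arcsD2 im by (metis imageE surj_pair)
    then have "(v, w) \<in> parcs G" using g e by (simp add: graph_map_def)
    then show "e \<in> map_prod g g ` parcs G" using vw by force
  qed
  then have "with_proj H = app_iso ?f (with_proj G)"
    using im by (simp add: app_iso_def)
  then show ?thesis unfolding digraph_iso_def using iso by blast
qed

lemma gen_eigenvector_graph_map:
  assumes G: "pair_graph G" and H: "pair_graph H" and g: "graph_map g G H"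
    and h: "gen_eigenvector c H x h"
  shows "gen_eigenvector c G x (h \<circ> g)"
proof -
  interpret G: pair_graph G by (rule G)
  interpret H: pair_graph H by (rule H)
  have inj: "inj_on g (pverts G)" and im: "g ` pverts G = pverts H"
    using g by (auto simp: graph_map_def bij_betw_def)
  have adj: "gen_adj c G (h \<circ> g) v = gen_adj c H h (g v)" if v: "v \<in> pverts G" for v
  proof -
    let ?N = "{w. (v, w) \<in> parcs G}"
    have N: "?N \<subseteq> pverts G" using G.in_arcsD2 by auto
    have "{w. (g v, w) \<in> parcs H} = g ` ?N"
    proof (intro equalityI subsetI)
      fix w assume w: "w \<in> {w. (g v, w) \<in> parcs H}"
      then obtain y where y: "y \<in> pverts G" "w = g y" using H.in_arcsD2 im by blast
      then show "w \<in> g ` ?N" using w g v by (auto simp: graph_map_def)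
    next
      fix w assume "w \<in> g ` ?N"
      then show "w \<in> {w. (g v, w) \<in> parcs H}" using g v N by (auto simp: graph_map_def)
    qed
    then show ?thesis
      unfolding gen_adj_def by (simp add: sum.reindex[OF inj_on_subset[OF inj N]])
  qed
  show ?thesis
    using h unfolding gen_eigenvector_def im[symmetric] by (simp add: adj)
qed

lemma gen_radius_graph_map:
  assumes G: "pair_graph G" and H: "pair_graph H" and g: "graph_map g G H"
  shows "gen_radius c G = gen_radius c H"
proof -
  have "(\<exists>h. gen_eigenvector c G x h) \<longleftrightarrow> (\<exists>h. gen_eigenvector c H x h)" for x
    using gen_eigenvector_graph_map[OF G H g] gen_eigenvector_graph_map[OF H G graph_map_inv[OF g]] by blast
  then show ?thesis by (simp add: gen_radius_def)
qed

section \<open>Bipartite graphs given by their edges\<close>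

definition bip :: "'a set \<Rightarrow> 'a set \<Rightarrow> ('a \<times> 'a) set \<Rightarrow> 'a pair_pre_digraph" where
  "bip A B E = \<lparr>pverts = A \<union> B, parcs = E \<union> E\<inverse>\<rparr>"

lemma bip_simps [simp]: "pverts (bip A B E) = A \<union> B" "parcs (bip A B E) = E \<union> E\<inverse>"
  by (simp_all add: bip_def)

lemma bipartite_graph_eq_bip:
  assumes "bipartite_graph A B G"
  shows "G = bip A B (parcs G \<inter> A \<times> B)"
proof -
  interpret pair_graph G using assms by (simp add: bipartite_graph_def)
  have "parcs G = (parcs G \<inter> A \<times> B) \<union> (parcs G \<inter> A \<times> B)\<inverse>"
    using assms arcs_symmetric by (auto simp: bipartite_graph_def)
  then show ?thesis using assms by (simp add: bip_def bipartite_graph_def)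
qed

locale two_parts =
  fixes A B :: "'a set"
  assumes finA: "finite A" and finB: "finite B" and disj: "A \<inter> B = {}"
begin

lemma finite_edges: "E \<subseteq> A \<times> B \<Longrightarrow> finite E"
  by (rule finite_subset[OF _ finite_cartesian_product[OF finA finB]])

lemma pair_graph_bip:
  assumes "E \<subseteq> A \<times> B"
  shows "pair_graph (bip A B E)"
  by unfold_locales (use assms finA finB disj finite_edges[OF assms] in \<open>auto simp: symmetric_def sym_def\<close>)

lemma nbrs_left: "a \<in> A \<Longrightarrow> E \<subseteq> A \<times> B \<Longrightarrow> {w. (a, w) \<in> parcs (bip A B E)} = E `` {a}"
  and nbrs_right: "b \<in> B \<Longrightarrow> E \<subseteq> A \<times> B \<Longrightarrow> {w. (b, w) \<in> parcs (bip A B E)} = E\<inverse> `` {b}"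
  using disj by auto

text \<open>
  Every edge contributes the same expression in the values at its ends. It is nondecreasing in
  nonnegative values if \<open>c \<ge> 0\<close>, so that forms of different edge sets can be compared edge by edge.
\<close>

lemma gen_form_bip:
  assumes E: "E \<subseteq> A \<times> B"
  shows "gen_form c (bip A B E) h = (\<Sum>(a, b)\<in>E. 2 * h a * h b + c * ((h a)\<^sup>2 + (h b)\<^sup>2))"
proof -
  have finE: "finite E" by (rule finite_edges[OF E])
  have fin: "finite (E `` {a})" "finite (E\<inverse> `` {a})" for a using finE by auto
  have "(\<Sum>a\<in>A. h a * gen_adj c (bip A B E) h a) = (\<Sum>a\<in>A. \<Sum>b\<in>E `` {a}. h a * (h b + c * h a))"
    by (intro sum.cong refl) (simp add: gen_adj_def nbrs_left[OF _ E, simplified] sum_distrib_left)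
  also have "\<dots> = (\<Sum>(a, b)\<in>Sigma A (\<lambda>a. E `` {a}). h a * (h b + c * h a))"
    using fin finA by (subst sum.Sigma) auto
  also have "Sigma A (\<lambda>a. E `` {a}) = E" using E by auto
  finally have 1: "(\<Sum>a\<in>A. h a * gen_adj c (bip A B E) h a) = (\<Sum>(a, b)\<in>E. h a * (h b + c * h a))" .
  have "(\<Sum>b\<in>B. h b * gen_adj c (bip A B E) h b) = (\<Sum>b\<in>B. \<Sum>a\<in>E\<inverse> `` {b}. h b * (h a + c * h b))"
    by (intro sum.cong refl) (simp add: gen_adj_def nbrs_right[OF _ E, simplified] sum_distrib_left)
  also have "\<dots> = (\<Sum>(b, a)\<in>Sigma B (\<lambda>b. E\<inverse> `` {b}). h b * (h a + c * h b))"
    using fin finB by (subst sum.Sigma) auto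
  also have "Sigma B (\<lambda>b. E\<inverse> `` {b}) = E\<inverse>" using E by auto
  also have "(\<Sum>(b, a)\<in>E\<inverse>. h b * (h a + c * h b)) = (\<Sum>(a, b)\<in>E. h b * (h a + c * h b))"
    by (rule sum.reindex_bij_witness[of _ prod.swap prod.swap]) auto
  finally have 2: "(\<Sum>b\<in>B. h b * gen_adj c (bip A B E) h b) = (\<Sum>(a, b)\<in>E. h b * (h a + c * h b))" .
  have "gen_form c (bip A B E) h
    = (\<Sum>a\<in>A. h a * gen_adj c (bip A B E) h a) + (\<Sum>b\<in>B. h b * gen_adj c (bip A B E) h b)"
    unfolding gen_form_def using finA finB disj by (simp add: sum.union_disjoint)
  also have "\<dots> = (\<Sum>(a, b)\<in>E. h a * (h b + c * h a) + h b * (h a + c * h b))"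
    unfolding 1 2 by (simp add: sum.distrib case_prod_unfold)
  also have "\<dots> = (\<Sum>(a, b)\<in>E. 2 * h a * h b + c * ((h a)\<^sup>2 + (h b)\<^sup>2))"
    by (intro sum.cong refl) (auto simp: algebra_simps power2_eq_square)
  finally show ?thesis .
qed

text \<open>
  Where a nonnegative eigenvector vanishes, the sum of its values at the neighbours is zero, so it vanishes
  at the neighbours as well. The vertex \<open>d\<close>, adjacent to all of \<open>A\<close>, then spreads the zero to \<open>A\<close>,
  and from there it reaches every vertex of \<open>B\<close>.
\<close>

lemma eigenvector_positive:
  assumes E: "E \<subseteq> A \<times> B" and h: "gen_eigenvector c (bip A B E) x h" "\<And>v. h v \<ge> 0"
    and hub: "d \<in> B" "A \<times> {d} \<subseteq> E" and cover: "B \<subseteq> E `` A" and v: "v \<in> A \<union> B"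
  shows "h v > 0"
proof (rule ccontr)
  assume "\<not> h v > 0"
  then have v0: "h v = 0" using h(2)[of v] by simp
  have finE: "finite E" by (rule finite_edges[OF E])
  have spread: "h w = 0" if "h u = 0" "(u, w) \<in> E \<or> (w, u) \<in> E" for u w
  proof -
    let ?N = "{w. (u, w) \<in> parcs (bip A B E)}"
    have u: "u \<in> A \<union> B" using that(2) E by auto
    have "gen_adj c (bip A B E) h u = 0"
      using h(1) u that(1) by (simp add: gen_eigenvector_def)
    then have "(\<Sum>w\<in>?N. h w) = 0" by (simp add: gen_adj_def that(1))
    moreover have "finite ?N"
      by (rule finite_subset[of _ "E `` {u} \<union> E\<inverse> `` {u}"]) (use finE in auto)
    ultimately show ?thesis using that(2) h(2) by (auto simp: sum_nonneg_eq_0_iff)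
  qed
  have "\<exists>a\<in>A. h a = 0"
  proof (cases "v \<in> A")
    case False
    then obtain a where "a \<in> A" "(a, v) \<in> E" using v cover by auto
    then show ?thesis using spread[OF v0] by blast
  qed (use v0 in blast)
  then have "h d = 0" using spread hub by blast
  then have A0: "h a = 0" if "a \<in> A" for a using that spread hub by blast
  then have "h b = 0" if "b \<in> B" for b using that spread cover by blast
  then show False using A0 h(1) by (auto simp: gen_eigenvector_def)
qed

text \<open>
  The Rayleigh quotient of \<open>h\<close> already gives \<open>\<le>\<close>. Equality would make \<open>h\<close> an eigenvector of both
  graphs for the same eigenvalue, hence positive, although at \<open>z\<close> the second graph has all neighbours of
  the first and at least one more.
\<close>

lemma gen_radius_less:
  assumes c: "c \<ge> 0" and E: "E \<subseteq> A \<times> B" and E': "E' \<subseteq> A \<times> B"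
    and h: "gen_eigenvector c (bip A B E) (gen_radius c (bip A B E)) h" "\<And>v. h v \<ge> 0"
    and form: "gen_form c (bip A B E) h \<le> gen_form c (bip A B E') h"
    and hub: "d \<in> B" "A \<times> {d} \<subseteq> E'" and cover: "B \<subseteq> E' `` A"
    and z: "z \<in> A \<union> B" "{w. (z, w) \<in> parcs (bip A B E)} \<subset> {w. (z, w) \<in> parcs (bip A B E')}"
  shows "gen_radius c (bip A B E) < gen_radius c (bip A B E')"
proof (rule ccontr)
  assume contr: "\<not> ?thesis"
  let ?G = "bip A B E" and ?H = "bip A B E'"
  let ?s = "\<Sum>v\<in>A \<union> B. (h v)\<^sup>2"
  have nz: "\<exists>v\<in>A \<union> B. h v \<noteq> 0" using h(1) by (simp add: gen_eigenvector_def)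
  have s: "?s > 0" using nz finA finB by (auto intro!: sum_pos2)
  have formG: "gen_form c ?G h = gen_radius c ?G * ?s" using gen_eigenvector_form[OF h(1)] by simp
  have ge: "gen_radius c ?H * ?s \<le> gen_radius c ?G * ?s"
    using contr s by (intro mult_right_mono) auto
  then have H: "gen_eigenvector c ?H (gen_radius c ?H) h"
    using gen_form_extremal_eigenvector[OF pair_graph_bip[OF E'], of h c] nz form formG by simp
  then have "gen_radius c ?G * ?s \<le> gen_radius c ?H * ?s"
    using gen_eigenvector_form[OF H] form formG by simp
  then have eq: "gen_radius c ?G = gen_radius c ?H" using s ge by (simp add: antisym)
  have pos: "h v > 0" if "v \<in> A \<union> B" for v
    by (rule eigenvector_positive[OF E' H h(2) hub cover that])
  have fin: "finite {w. (z, w) \<in> parcs ?H}"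
    by (rule finite_subset[of _ "A \<union> B"]) (use E' finA finB in auto)
  obtain w where w: "w \<in> {w. (z, w) \<in> parcs ?H} - {w. (z, w) \<in> parcs ?G}" using z(2) by blast
  have "gen_adj c ?G h z < gen_adj c ?H h z"
    unfolding gen_adj_def
  proof (rule sum_strict_mono2[OF fin])
    show "w \<in> {w. (z, w) \<in> parcs ?H} - {w. (z, w) \<in> parcs ?G}" by (rule w)
    show "0 < h w + c * h z"
      using w pos[of w] h(2)[of z] c E' by (intro add_pos_nonneg) auto
  qed (use z(2) h(2) c in auto)
  moreover have "gen_adj c ?G h z = gen_adj c ?H h z"
    using h(1) H z(1) eq by (simp add: gen_eigenvector_def)
  ultimately show False by simp
qed

lemma gen_form_mono:
  assumes "c \<ge> 0" "E \<subseteq> E'" "E' \<subseteq> A \<times> B" "\<And>v. h v \<ge> 0"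
  shows "gen_form c (bip A B E) h \<le> gen_form c (bip A B E') h"
proof -
  have "finite E'" by (rule finite_edges[OF assms(3)])
  then show ?thesis
    using assms by (subst (1 2) gen_form_bip) (auto intro!: sum_mono2 add_nonneg_nonneg mult_nonneg_nonneg)
qed

end

section \<open>Nonedges of a closed bipartite graph\<close>

lemma card_Sigma_Image_le:
  assumes fin: "finite N" "finite S"
  shows "(\<Sum>a\<in>S. card (N `` {a})) \<le> card N"
proof -
  have "(\<Sum>a\<in>S. card (N `` {a})) = card (Sigma S (\<lambda>a. N `` {a}))"
    using fin by (subst card_SigmaI) (auto intro: finite_Image)
  also have "\<dots> \<le> card N" using fin by (intro card_mono) auto
  finally show ?thesis .
qed

text \<open>
  Let \<open>L\<close> be the rows with \<open>m\<close> elements. There is room for at most \<open>r\<close> of them, so they are exactly the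
  rows that meet the column of \<open>v\<close>. A pair \<open>(w, t)\<close> in another row would have a short row, hence by the
  sum condition a long column, and its row and column outside the rows of \<open>L\<close> would add \<open>m - 1\<close> pairs to
  the \<open>r m\<close> pairs in the rows of \<open>L\<close>, which is too many. So all pairs lie in the \<open>r\<close> rows of \<open>L\<close>, and
  the sum condition fills every column that occurs.
\<close>

lemma nonedges_rectangle_aux:
  fixes N :: "('a \<times> 'b) set"
  assumes fin: "finite N" and m: "m > 0"
    and uv: "(u, v) \<in> N" "card (N\<inverse> `` {v}) = r" "\<And>w. (w, v) \<in> N \<Longrightarrow> card (N `` {w}) = m"
    and sum: "\<And>a b. (a, b) \<in> N \<Longrightarrow> m + r \<le> card (N `` {a}) + card (N\<inverse> `` {b})"
    and small: "card N < (m - 1) * (r + 1)"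
  shows "\<exists>L T. N = L \<times> T \<and> card L = r \<and> card T = m"
proof -
  define L where "L = {w. card (N `` {w}) = m}"
  have small': "card N + r + 1 < (r + 1) * m" using small m by (cases m) (auto simp: algebra_simps)
  have "L \<subseteq> Domain N"
  proof
    fix w assume "w \<in> L"
    then have "N `` {w} \<noteq> {}" using m unfolding L_def by (auto simp: card_gt_0_iff)
    then show "w \<in> Domain N" by blast
  qed
  then have finL: "finite L" using fin by (meson finite_Domain finite_subset)
  have sumL: "(\<Sum>w\<in>L. card (N `` {w})) = card L * m" by (simp add: L_def)
  have "card L \<le> r"
  proof (rule ccontr)
    assume "\<not> card L \<le> r"
    then have "(r + 1) * m \<le> card L * m" by (intro mult_right_mono) auto
    also have "\<dots> \<le> card N" using card_Sigma_Image_le[OF fin finL] sumL by simp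
    finally show False using small' by simp
  qed
  moreover have "N\<inverse> `` {v} \<subseteq> L" using uv(3) by (auto simp: L_def)
  ultimately have L: "N\<inverse> `` {v} = L" using uv(2) finL by (metis card_seteq)
  then have cardL: "card L = r" using uv(2) by simp
  have NL: "w \<in> L" if wt: "(w, t) \<in> N" for w t
  proof (rule ccontr)
    assume w: "w \<notin> L"
    \<comment> \<open>disjoint parts of \<open>N\<close>: the rows of \<open>L\<close>, and outside of them the column of \<open>t\<close> and the rest of the row of \<open>w\<close>\<close>
    define X1 X2 X3 where "X1 = Sigma L (\<lambda>a. N `` {a})" and "X2 = (N\<inverse> `` {t} - L) \<times> {t}"
      and "X3 = {w} \<times> (N `` {w} - {t})"
    have fX: "finite X1" "finite X2" "finite X3"
      unfolding X1_def X2_def X3_def using fin finL by auto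
    have "card X1 = r * m"
      unfolding X1_def using fin finL sumL cardL by (subst card_SigmaI) (auto intro: finite_Image)
    moreover have "card (N\<inverse> `` {t}) \<le> card X2 + r"
    proof -
      have "card (N\<inverse> `` {t}) - card L \<le> card (N\<inverse> `` {t} - L)" by (rule diff_card_le_card_Diff[OF finL])
      then show ?thesis unfolding X2_def cardL by (simp add: card_cartesian_product)
    qed
    moreover have "card (N `` {w}) = card X3 + 1"
      using wt fin unfolding X3_def
      by (simp add: card_Diff_singleton) (metis Image_singleton_iff Suc_pred card_gt_0_iff empty_iff finite_Image)
    moreover have "card (X1 \<union> X2 \<union> X3) = card X1 + card X2 + card X3"
    proof -
      have "card (X1 \<union> X2 \<union> X3) = card (X1 \<union> X2) + card X3"
        using fX w by (intro card_Un_disjoint) (auto simp: X1_def X2_def X3_def)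
      also have "card (X1 \<union> X2) = card X1 + card X2"
        using fX by (intro card_Un_disjoint) (auto simp: X1_def X2_def)
      finally show ?thesis .
    qed
    moreover have "card (X1 \<union> X2 \<union> X3) \<le> card N"
      using wt fin by (intro card_mono) (auto simp: X1_def X2_def X3_def)
    ultimately show False using sum[OF wt] small' by (simp add: algebra_simps)
  qed
  have col: "N\<inverse> `` {t} = L" if "t \<in> Range N" for t
  proof -
    obtain w where w: "(w, t) \<in> N" using \<open>t \<in> Range N\<close> by (auto simp: Range_iff)
    have "N\<inverse> `` {t} \<subseteq> L" using NL by blast
    moreover have "card L \<le> card (N\<inverse> `` {t})"
      using sum[OF w] NL[OF w] cardL by (simp add: L_def)
    ultimately show ?thesis using finL by (metis card_seteq)
  qed
  have colI: "(w, t) \<in> N" if "w \<in> L" "t \<in> Range N" for w t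
    using col[OF that(2)] that(1) by blast
  have "N = L \<times> Range N"
    using NL colI by (intro equalityI subrelI) (auto simp: Range_iff)
  moreover have "card (Range N) = m"
  proof -
    have "N `` {u} = Range N" using colI[OF NL[OF uv(1)]] by auto
    then show ?thesis using uv(1,3) by metis
  qed
  ultimately show ?thesis using cardL by metis
qed

text \<open>
  For \<open>p, q \<le> m - 1\<close> the sum condition gives \<open>p, q \<ge> r + 1\<close>. The product at a given sum is smallest at
  the ends of the admissible range, where it is at least \<open>(m - 1) (r + 1)\<close>.
\<close>

lemma rectangle_sides:
  fixes p q m r :: int
  assumes "p \<le> m" "q \<le> m" "m + r \<le> p + q" "1 \<le> m" "0 \<le> r" and small: "p * q < (m - 1) * (r + 1)"
  shows "p = m \<and> q = r \<or> p = r \<and> q = m"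
proof -
  have side: "y = r" if "x = m" "m + r \<le> x + y" "x * y < (m - 1) * (r + 1)" for x y
  proof (rule ccontr)
    assume "y \<noteq> r"
    then have "m * (r + 1) \<le> x * y" using that assms by (simp add: mult_left_mono)
    then show False using that assms by (simp add: algebra_simps)
  qed
  have "p = m \<or> q = m"
  proof (rule ccontr)
    assume "\<not> ?thesis"
    then have le: "p \<le> m - 1" "r + 1 \<le> p" using assms by auto
    then have "0 \<le> (p - (r + 1)) * (m - 1 - p)" by simp
    also have "\<dots> = p * (m + r - p) - (m - 1) * (r + 1)" by (simp add: algebra_simps)
    also have "p * (m + r - p) \<le> p * q" using assms le by (intro mult_left_mono) auto
    finally show False using small by simp
  qed
  then show ?thesis using side[of p q] side[of q p] assms by (auto simp: mult.commute add.commute)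
qed

text \<open>
  Choose \<open>(u, v)\<close> in \<open>N\<close> with the smallest sum of the sizes \<open>p\<close> of its row and \<open>q\<close> of its column. Every
  row that meets the column of \<open>v\<close> then has at least \<open>p\<close> elements, so \<open>N\<close> has at least \<open>p q\<close>, and
  \<open>rectangle_sides\<close> leaves only \<open>{p, q} = {m, r}\<close>.
\<close>

lemma nonedges_rectangle:
  fixes N :: "('a \<times> 'b) set"
  assumes fin: "finite N" and ne: "N \<noteq> {}"
    and row: "\<And>a b. (a, b) \<in> N \<Longrightarrow> card (N `` {a}) \<le> m"
    and col: "\<And>a b. (a, b) \<in> N \<Longrightarrow> card (N\<inverse> `` {b}) \<le> m"
    and sum: "\<And>a b. (a, b) \<in> N \<Longrightarrow> m + r \<le> card (N `` {a}) + card (N\<inverse> `` {b})"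
    and small: "card N < (m - 1) * (r + 1)"
  obtains L T where "N = L \<times> T" "card L = r" "card T = m"
    | L T where "N = L \<times> T" "card L = m" "card T = r"
proof -
  define f where "f = (\<lambda>(a, b). card (N `` {a}) + card (N\<inverse> `` {b}))"
  obtain u v where uv: "(u, v) \<in> N" and min: "\<And>a b. (a, b) \<in> N \<Longrightarrow> f (u, v) \<le> f (a, b)"
    using ex_min_if_finite[of "f ` N"] fin ne
    by (metis (no_types, lifting) arg_min_if_finite(1) arg_min_least surj_pair)
  define p q where "p = card (N `` {u})" and "q = card (N\<inverse> `` {v})"
  have pm: "p \<le> m" and qm: "q \<le> m" and pq: "m + r \<le> p + q"
    using row[OF uv] col[OF uv] sum[OF uv] by (auto simp: p_def q_def)
  have m: "m > 0" using small by (cases m) auto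
  have rows: "p \<le> card (N `` {w})" if "(w, v) \<in> N" for w
    using min[OF that] by (simp add: f_def p_def)
  have cols: "q \<le> card (N\<inverse> `` {t})" if "(u, t) \<in> N" for t
    using min[OF that] by (simp add: f_def q_def)
  have "p * q \<le> card N"
  proof -
    have "p * q = (\<Sum>w\<in>N\<inverse> `` {v}. p)" by (simp add: q_def)
    also have "\<dots> \<le> (\<Sum>w\<in>N\<inverse> `` {v}. card (N `` {w}))" by (intro sum_mono rows) auto
    also have "\<dots> \<le> card N" using fin by (intro card_Sigma_Image_le) auto
    finally show ?thesis .
  qed
  then have pq_small: "p * q < (m - 1) * (r + 1)" using small by simp
  have "int (p * q) < int ((m - 1) * (r + 1))" using pq_small by (simp only: of_nat_less_iff)
  then have "int p * int q < (int m - 1) * (int r + 1)"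
    using m by (simp only: of_nat_mult of_nat_add of_nat_1 int_ops(6)) simp
  then have "p = m \<and> q = r \<or> p = r \<and> q = m"
    using rectangle_sides[of "int p" "int m" "int q" "int r"] pm qm pq m by auto
  then show thesis
  proof
    assume pq: "p = m \<and> q = r"
    have "\<exists>L T. N = L \<times> T \<and> card L = r \<and> card T = m"
      by (rule nonedges_rectangle_aux[OF fin m uv]) (use pq rows row sum small in \<open>force simp: q_def\<close>)+
    then show thesis using that(1) by blast
  next
    assume pq: "p = r \<and> q = m"
    have "\<exists>L T. N\<inverse> = L \<times> T \<and> card L = r \<and> card T = m"
    proof (rule nonedges_rectangle_aux[where u = v and v = u])
      show "card (N\<inverse>) < (m - 1) * (r + 1)" using small by (simp add: card_inverse)
    qed (use pq cols col sum fin uv m in \<open>force simp: p_def add.commute\<close>)+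
    then obtain L T where "N\<inverse> = L \<times> T" "card L = r" "card T = m" by blast
    then have "N = (L \<times> T)\<inverse>" by (metis converse_converse)
    then have "N = T \<times> L" by auto
    then show thesis using that(2) \<open>card L = r\<close> \<open>card T = m\<close> by blast
  qed
qed

section \<open>Upper bounds for the radii by the number of edges\<close>

context two_parts
begin

lemma degree_bip_left: "a \<in> A \<Longrightarrow> E \<subseteq> A \<times> B \<Longrightarrow> degree_of (bip A B E) a = card (E `` {a})"
  by (simp only: degree_of_eq_card nbrs_left)

lemma degree_bip_right: "b \<in> B \<Longrightarrow> E \<subseteq> A \<times> B \<Longrightarrow> degree_of (bip A B E) b = card (E\<inverse> `` {b})"
  by (simp only: degree_of_eq_card nbrs_right)

text \<open>
  Cauchy's inequality over the edges bounds the form by \<open>2 \<surd>e \<surd>(p q)\<close>, where \<open>p\<close> and \<open>q\<close> are the squared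
  norms of \<open>h\<close> on the two sides, and \<open>2 \<surd>(p q) \<le> p + q\<close>.
\<close>

lemma adj_radius_sq_le_edges:
  assumes E: "E \<subseteq> A \<times> B" and ne: "A \<union> B \<noteq> {}"
  shows "(gen_radius 0 (bip A B E))\<^sup>2 \<le> card E"
proof -
  let ?G = "bip A B E"
  obtain h where h: "gen_eigenvector 0 ?G (gen_radius 0 ?G) h"
    using ex_gen_eigenvector_radius[OF pair_graph_bip[OF E]] ne by auto
  define p q where "p = (\<Sum>a\<in>A. (h a)\<^sup>2)" and "q = (\<Sum>b\<in>B. (h b)\<^sup>2)"
  have pq: "p + q = (\<Sum>v\<in>A \<union> B. (h v)\<^sup>2)"
    unfolding p_def q_def using finA finB disj by (simp add: sum.union_disjoint)
  have "\<exists>v\<in>A \<union> B. h v \<noteq> 0" using h by (simp add: gen_eigenvector_def)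
  then have pos: "p + q > 0" unfolding pq using finA finB by (auto intro!: sum_pos2)
  have "gen_radius 0 ?G * (p + q) = 2 * (\<Sum>(a, b)\<in>E. h a * h b)"
    using gen_eigenvector_form[OF h] gen_form_bip[OF E, of 0 h] pq
    by (simp add: sum_distrib_left case_prod_unfold mult.assoc)
  then have "(gen_radius 0 ?G * (p + q))\<^sup>2 = (2 * (\<Sum>(a, b)\<in>E. h a * h b))\<^sup>2" by (rule arg_cong)
  then have "(gen_radius 0 ?G)\<^sup>2 * (p + q)\<^sup>2 = 4 * (\<Sum>(a, b)\<in>E. h a * h b)\<^sup>2"
    by (simp only: power_mult_distrib) simp
  also have "(\<Sum>(a, b)\<in>E. h a * h b)\<^sup>2 \<le> (\<Sum>(a, b)\<in>E. (h a * h b)\<^sup>2) * card E"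
    using sum_squared_le_sum_of_squares[of "\<lambda>(a, b). h a * h b" E] finite_edges[OF E]
    by (simp add: case_prod_unfold)
  also have "(\<Sum>(a, b)\<in>E. (h a * h b)\<^sup>2) \<le> (\<Sum>(a, b)\<in>A \<times> B. (h a * h b)\<^sup>2)"
    using E finA finB by (intro sum_mono2) auto
  also have "\<dots> = p * q"
    unfolding p_def q_def sum_product by (simp add: sum.cartesian_product power_mult_distrib)
  also have "4 * (p * q * card E) \<le> (p + q)\<^sup>2 * card E"
  proof -
    have "0 \<le> (p - q)\<^sup>2" by simp
    then have "4 * (p * q) \<le> (p + q)\<^sup>2" by (simp add: power2_eq_square algebra_simps)
    then show ?thesis by (metis mult.assoc mult_right_mono of_nat_0_le_iff)
  qed
  finally have "(gen_radius 0 ?G)\<^sup>2 * (p + q)\<^sup>2 \<le> card E * (p + q)\<^sup>2" by (simp add: mult_right_mono mult.commute)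
  then show ?thesis using pos by simp
qed

text \<open>
  After multiplication by \<open>n d\<close>, the difference of the two sides is a sum of two nonnegative products.
\<close>

lemma degree_plus_mean_le:
  fixes d s e n :: real
  assumes "0 < d" "d \<le> n" "s \<le> e" "s \<le> n * d"
  shows "d + s / d \<le> n + e / n"
proof -
  have "0 \<le> (n - d) * (n * d - s) + d * (e - s)" using assms by (intro add_nonneg_nonneg mult_nonneg_nonneg) auto
  also have "\<dots> = n * d * (n + e / n - (d + s / d))"
  proof -
    have "n * d * (e / n) = d * e" "n * d * (s / d) = n * s" using assms by auto
    then have "n * d * (n + e / n - (d + s / d)) = n * d * n + d * e - (n * d * d + n * s)"
      by (simp only: right_diff_distrib distrib_left)
    then show ?thesis by (simp add: algebra_simps)
  qed
  finally have "0 \<le> n * d * (n + e / n - (d + s / d))" .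
  moreover have "n * d > 0" using assms by simp
  ultimately have "0 \<le> n + e / n - (d + s / d)" using zero_le_mult_iff by (metis not_less)
  then show ?thesis by simp
qed

text \<open>
  At a vertex \<open>v\<close> that maximises \<open>h(v) / d(v)\<close> the eigenvalue equation gives \<open>\<mu> \<le> d(v) + s / d(v)\<close>, where
  \<open>s\<close> is the sum of the degrees of the neighbours of \<open>v\<close>. These are all on the other side, so \<open>s\<close> is at
  most the number of edges.
\<close>

lemma signless_radius_le_edges:
  assumes E: "E \<subseteq> A \<times> B" and n: "card A = n" "card B = n" "n > 0"
    and deg: "\<And>v. v \<in> A \<union> B \<Longrightarrow> degree_of (bip A B E) v > 0"
  shows "gen_radius 1 (bip A B E) \<le> n + card E / n"
proof -
  let ?G = "bip A B E"
  define d where "d v = degree_of ?G v" for v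
  define N where "N v = {w. (v, w) \<in> parcs ?G}" for v
  have dN: "d v = card (N v)" for v by (simp only: d_def N_def degree_of_eq_card)
  have fAB: "finite (A \<union> B)" and ne: "A \<union> B \<noteq> {}" using finA finB n by auto
  obtain h where h: "gen_eigenvector 1 ?G (gen_radius 1 ?G) h" "\<And>v. h v \<ge> 0"
    using ex_nonneg_gen_eigenvector[OF pair_graph_bip[OF E]] ne by auto
  let ?F = "(\<lambda>v. h v / d v) ` (A \<union> B)"
  have F: "finite ?F" "?F \<noteq> {}" using fAB ne by auto
  obtain v where v_max: "Max ?F = h v / d v" and v: "v \<in> A \<union> B" using Max_in[OF F] by (rule imageE)
  have max: "h w / d w \<le> h v / d v" if "w \<in> A \<union> B" for w
    unfolding v_max[symmetric] using that F by (intro Max_ge) auto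
  have dpos: "d w > 0" if "w \<in> A \<union> B" for w using deg[OF that] by (simp add: d_def)
  have N_sub: "N v \<subseteq> A \<union> B" using E by (auto simp: N_def)
  have hv: "h v > 0"
  proof (rule ccontr)
    assume "\<not> h v > 0"
    then have "h v = 0" using h(2)[of v] by simp
    then have "h w / d w \<le> 0" if "w \<in> A \<union> B" for w using max[OF that] by simp
    then have "h w = 0" if "w \<in> A \<union> B" for w
      using h(2)[of w] dpos[OF that] that by (fastforce simp: divide_le_0_iff)
    then show False using h(1) by (simp add: gen_eigenvector_def)
  qed
  have d_le: "d w \<le> n" if "w \<in> A \<union> B" for w
  proof (cases "w \<in> A")
    case True
    have "card (E `` {w}) \<le> card B" using E finB by (intro card_mono) auto
    then show ?thesis using n by (simp add: d_def degree_bip_left[OF True E])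
  next
    case False
    then have w: "w \<in> B" using that by blast
    have "card (E\<inverse> `` {w}) \<le> card A" using E finA by (intro card_mono) auto
    then show ?thesis using n by (simp add: d_def degree_bip_right[OF w E])
  qed
  define s where "s = (\<Sum>w\<in>N v. d w)"
  have s_edges: "s \<le> card E"
  proof (cases "v \<in> A")
    case True
    have Nv: "N v = E `` {v}" unfolding N_def by (rule nbrs_left[OF True E])
    then have "s = (\<Sum>w\<in>E `` {v}. card (E\<inverse> `` {w}))"
      unfolding s_def using E by (intro sum.cong) (auto simp: d_def degree_bip_right[OF _ E])
    also have "\<dots> \<le> card (E\<inverse>)" using finite_edges[OF E] by (intro card_Sigma_Image_le) auto
    finally show ?thesis by simp
  next
    case False
    then have vB: "v \<in> B" using v by blast
    have Nv: "N v = E\<inverse> `` {v}" unfolding N_def by (rule nbrs_right[OF vB E])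
    then have "s = (\<Sum>w\<in>E\<inverse> `` {v}. card (E `` {w}))"
      unfolding s_def using E by (intro sum.cong) (auto simp: d_def degree_bip_left[OF _ E])
    also have "\<dots> \<le> card E" using finite_edges[OF E] by (intro card_Sigma_Image_le) auto
    finally show ?thesis by simp
  qed
  have "s \<le> (\<Sum>w\<in>N v. n)" unfolding s_def using N_sub d_le by (intro sum_mono) auto
  then have s_deg: "s \<le> n * d v" by (simp add: dN mult.commute)
  have "gen_radius 1 ?G * h v = gen_adj 1 ?G h v"
    using h(1) v by (simp add: gen_eigenvector_def)
  also have "\<dots> = (\<Sum>w\<in>N v. h w) + d v * h v"
    unfolding gen_adj_def dN N_def[symmetric] by (simp add: sum.distrib)
  also have "(\<Sum>w\<in>N v. h w) \<le> (\<Sum>w\<in>N v. d w * (h v / d v))"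
    using max dpos N_sub by (intro sum_mono) (auto simp: pos_divide_le_eq mult.commute subset_iff)
  also have "\<dots> = s / d v * h v" by (simp add: s_def sum_distrib_right sum_divide_distrib)
  finally have "gen_radius 1 ?G * h v \<le> (d v + s / d v) * h v" by (simp add: algebra_simps)
  then have "gen_radius 1 ?G \<le> d v + s / d v" using hv by simp
  also have "\<dots> \<le> n + card E / n"
  proof (rule degree_plus_mean_le)
    show "real s \<le> real n * real (d v)" using s_deg by (simp flip: of_nat_mult)
  qed (use dpos[OF v] d_le[OF v] s_edges in auto)
  finally show ?thesis .
qed

end

section \<open>The graphs \<open>F\<close> and \<open>F\<^sup>0\<close> inside a complete bipartite graph\<close>

text \<open>
  The isomorphisms must respect a side of the bipartition, the subset on it that bounds the deleted
  rectangle, and the end of the additional deleted edge.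
\<close>

lemma pointed_bij:
  assumes fin: "finite A" "finite A'" and card: "card A = card A'" "card L = card L'"
    and L: "L \<subseteq> A" "L' \<subseteq> A'" and u: "u \<in> A - L" "u' \<in> A' - L'"
  obtains g where "bij_betw g A A'" "\<And>x. x \<in> A \<Longrightarrow> g x \<in> L' \<longleftrightarrow> x \<in> L" "\<And>x. x \<in> A \<Longrightarrow> g x = u' \<longleftrightarrow> x = u"
proof -
  have fL: "finite L" "finite L'" using L fin finite_subset by auto
  define R R' where "R = A - L - {u}" and "R' = A' - L' - {u'}"
  have "card R = card R'"
    using fin fL L u card by (simp add: R_def R'_def card_Diff_singleton card_Diff_subset)
  then obtain g2 where g2: "bij_betw g2 R R'"
    using finite_same_card_bij[of R R'] fin by (auto simp: R_def R'_def)
  obtain g1 where g1: "bij_betw g1 L L'" using finite_same_card_bij[OF fL card(2)] by blast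
  define g where "g x = (if x \<in> L then g1 x else if x = u then u' else g2 x)" for x
  have 1: "bij_betw g L L'" using g1 by (rule bij_betw_cong[THEN iffD1, rotated]) (simp add: g_def)
  have 2: "bij_betw g R R'" using g2 by (rule bij_betw_cong[THEN iffD1, rotated]) (auto simp: g_def R_def)
  have 3: "bij_betw g {u} {u'}" using u by (auto simp: g_def bij_betw_def)
  have "bij_betw g (L \<union> R) (L' \<union> R')" by (rule bij_betw_combine[OF 1 2]) (auto simp: R'_def)
  then have "bij_betw g (L \<union> R \<union> {u}) (L' \<union> R' \<union> {u'})"
    by (rule bij_betw_combine[OF _ 3]) (use u in \<open>auto simp: R'_def\<close>)
  moreover have "L \<union> R \<union> {u} = A" "L' \<union> R' \<union> {u'} = A'" using L u by (auto simp: R_def R'_def)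
  ultimately have bij: "bij_betw g A A'" by simp
  then have inj: "inj_on g A" by (simp add: bij_betw_def)
  have "g x \<in> L' \<longleftrightarrow> x \<in> L" if "x \<in> A" for x
    using inj_on_image_mem_iff[OF inj that L(1)] 1 by (simp add: bij_betw_def)
  moreover have "g x = u' \<longleftrightarrow> x = u" if "x \<in> A" for x
    using inj_on_eq_iff[OF inj that, of u] u by (simp add: g_def)
  ultimately show thesis using that bij by blast
qed

lemma Z_graph_eq_bip:
  "Z_graph n k a b = bip (Inr ` {..<a + b}) (Inl ` {..<n})
     (Inr ` {..<a + b} \<times> Inl ` {..<n} - Inr ` {..<b} \<times> Inl ` {..<n - k})"
  by (auto simp: Z_graph_def bip_def Let_def)

lemma Z0_graph_eq_bip:
  "Z0_graph n k a b = bip (Inr ` {..<a + b}) (Inl ` {..<n})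
     (Inr ` {..<a + b} \<times> Inl ` {..<n} - Inr ` {..<b} \<times> Inl ` {..<n - k} - {(Inr b, Inl 0)})"
  unfolding Z0_graph_def Z_graph_eq_bip by (auto simp: del_edge_def bip_def)

lemma pair_graph_Z0: "pair_graph (Z0_graph n k a b)"
  and pair_graph_Z: "pair_graph (Z_graph n k a b)"
proof -
  interpret two_parts "Inr ` {..<a + b} :: (nat + nat) set" "Inl ` {..<n}"
    by unfold_locales auto
  show "pair_graph (Z0_graph n k a b)" "pair_graph (Z_graph n k a b)"
    unfolding Z0_graph_eq_bip Z_graph_eq_bip by (rule pair_graph_bip; blast)+
qed

context two_parts
begin

lemma Z_graph_iso:
  assumes card: "card B = n" "card A = a + b" and L: "L \<subseteq> A" "card L = b" and T: "T \<subseteq> B" "card T = n - k"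
    and u: "u \<in> A - L" and t: "t \<in> T" and a: "a > 0" and k: "k < n"
  obtains g where "graph_map g (bip A B (A \<times> B - L \<times> T)) (Z_graph n k a b)"
    "graph_map g (bip A B (A \<times> B - L \<times> T - {(u, t)})) (Z0_graph n k a b)"
proof -
  define Y X Y1 X1 :: "(nat + nat) set" where "Y = Inr ` {..<a + b}" and "X = Inl ` {..<n}"
    and "Y1 = Inr ` {..<b}" and "X1 = Inl ` {..<n - k}"
  note defs = Y_def X_def Y1_def X1_def
  have disj': "Y \<inter> X = {}" by (auto simp: defs)
  obtain g1 where g1: "bij_betw g1 A Y" "\<And>x. x \<in> A \<Longrightarrow> g1 x \<in> Y1 \<longleftrightarrow> x \<in> L"
    "\<And>x. x \<in> A \<Longrightarrow> g1 x = Inr b \<longleftrightarrow> x = u"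
    by (rule pointed_bij[of A Y L Y1 u "Inr b"]) (use finA card L u a in \<open>auto simp: defs card_image\<close>)
  \<comment> \<open>\<open>t\<close> lies in \<open>T\<close>, so the subset to be respected that does not contain it is \<open>B - T\<close>\<close>
  obtain g2 where g2: "bij_betw g2 B X" "\<And>x. x \<in> B \<Longrightarrow> g2 x \<in> X - X1 \<longleftrightarrow> x \<in> B - T"
    "\<And>x. x \<in> B \<Longrightarrow> g2 x = Inl 0 \<longleftrightarrow> x = t"
  proof (rule pointed_bij[of B X "B - T" "X - X1" t "Inl 0"])
    have "card X = n" "card X1 = n - k" "X1 \<subseteq> X" by (auto simp: defs card_image)
    then show "card (B - T) = card (X - X1)"
      using T card finB by (simp add: card_Diff_subset finite_subset[OF T(1)] finite_subset[of X1 X]) (auto simp: defs card_Diff_subset)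
  qed (use finB card T t k in \<open>auto simp: defs card_image\<close>)
  define g where "g x = (if x \<in> A then g1 x else g2 x)" for x
  have gA: "g x = g1 x" if "x \<in> A" for x using that by (simp add: g_def)
  have gB: "g x = g2 x" if "x \<in> B" for x using that disj by (auto simp: g_def)
  have bA: "bij_betw g A Y" using g1(1) gA by (metis bij_betw_cong)
  have bB: "bij_betw g B X" using g2(1) gB by (metis bij_betw_cong)
  have bij: "bij_betw g (A \<union> B) (Y \<union> X)" by (rule bij_betw_combine[OF bA bB disj'])
  have memY: "g x \<in> Y \<longleftrightarrow> x \<in> A" and memX: "g x \<in> X \<longleftrightarrow> x \<in> B" if "x \<in> A \<union> B" for x
    using that bij_betwE[OF bA] bij_betwE[OF bB] disj disj' by auto
  have memY1: "g x \<in> Y1 \<longleftrightarrow> x \<in> L" and mem_u: "g x = Inr b \<longleftrightarrow> x = u" if "x \<in> A" for x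
    using g1(2,3)[OF that] gA[OF that] by auto
  have memX1: "g x \<in> X1 \<longleftrightarrow> x \<in> T" and mem_t: "g x = Inl 0 \<longleftrightarrow> x = t" if "x \<in> B" for x
    using g2(2,3)[OF that] gB[OF that] that memX[of x] by auto
  have bu: "Inr b \<in> Y" and "Inl 0 \<in> X" using a k by (auto simp: defs)
  have Y1Y: "Y1 \<subseteq> Y" "X1 \<subseteq> X" by (auto simp: defs)
  have iff1: "(x, y) \<in> A \<times> B - L \<times> T \<longleftrightarrow> (g x, g y) \<in> Y \<times> X - Y1 \<times> X1"
    and iff2: "(x, y) \<in> A \<times> B - L \<times> T - {(u, t)} \<longleftrightarrow> (g x, g y) \<in> Y \<times> X - Y1 \<times> X1 - {(Inr b, Inl 0)}"
    if "x \<in> A \<union> B" "y \<in> A \<union> B" for x y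
    using memY[OF that(1)] memX[OF that(2)] memY1[of x] memX1[of y] mem_u[of x] mem_t[of y] by auto
  show thesis
  proof (rule that)
    show "graph_map g (bip A B (A \<times> B - L \<times> T)) (Z_graph n k a b)"
      unfolding graph_map_def Z_graph_eq_bip defs[symmetric] bip_simps Un_iff converse_iff
      using bij iff1 by blast
    show "graph_map g (bip A B (A \<times> B - L \<times> T - {(u, t)})) (Z0_graph n k a b)"
      unfolding graph_map_def Z0_graph_eq_bip defs[symmetric] bip_simps Un_iff converse_iff
      using bij iff2 by blast
  qed
qed

lemma gen_radius_F0_eq:
  assumes card: "card B = n" "card A = a + b" and L: "L \<subseteq> A" "card L = b" and T: "T \<subseteq> B" "card T = n - k"
    and u: "u \<in> A - L" and t: "t \<in> T" and a: "a > 0" and k: "k < n"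
  shows "gen_radius c (bip A B (A \<times> B - L \<times> T - {(u, t)})) = gen_radius c (Z0_graph n k a b)"
proof -
  have "pair_graph (bip A B (A \<times> B - L \<times> T - {(u, t)}))" by (rule pair_graph_bip) auto
  then show ?thesis
    using Z_graph_iso[OF assms] gen_radius_graph_map pair_graph_Z0 by metis
qed

end

section \<open>A large radius leaves few nonedges\<close>

text \<open>
  The fourth estimate lets \<open>nonedges_rectangle\<close> apply to the number of nonedges that a large radius
  leaves; for \<open>k = 1\<close>, \<open>s = 0\<close> and \<open>n = 8\<close> it is an equality. The fifth makes the test vector for the signless
  Laplacian good enough.
\<close>

lemma size_estimates:
  fixes n k s :: nat
  assumes n: "4 * k * (k + 1) \<le> n" and k: "1 \<le> k" and s: "s \<le> k"
  defines "a \<equiv> n + s - k - 1" and "r \<equiv> k + 1 - s"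
  shows "a + r = n" "k < n" "2 \<le> a" "n * r + 2 \<le> (n - k - 1) * (r + 1)" "n + a < k * a\<^sup>2"
proof -
  have kk: "4 * k + 4 \<le> 4 * k * (k + 1)" using k by (cases k) auto
  then have nk: "4 * k + 4 \<le> n" using n by linarith
  then show 1: "a + r = n" "k < n" "2 \<le> a" using s k by (auto simp: a_def r_def)
  have "(k + 1) * (r + 1) + 2 \<le> (k + 1) * (k + 2) + 2"
    by (intro add_right_mono mult_left_mono) (auto simp: r_def)
  also have "\<dots> \<le> 4 * k * (k + 1)"
  proof -
    obtain j where "k = Suc j" using k by (cases k) auto
    then show ?thesis by (simp add: algebra_simps)
  qed
  finally have "(k + 1) * (r + 1) + 2 \<le> n" using n by linarith
  moreover have "(n - k - 1) * (r + 1) = n * (r + 1) - (k + 1) * (r + 1)"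
    by (simp only: diff_diff_left diff_mult_distrib)
  moreover have "n * (r + 1) = n * r + n" by simp
  ultimately show "n * r + 2 \<le> (n - k - 1) * (r + 1)" by linarith
  have a: "n \<le> 2 * a" "4 \<le> a" using nk k s by (auto simp: a_def)
  then have "n + a < 4 * a" by linarith
  also have "\<dots> \<le> a\<^sup>2" using a by (simp add: power2_eq_square)
  also have "\<dots> \<le> k * a\<^sup>2" using k by simp
  finally show "n + a < k * a\<^sup>2" .
qed

context two_parts
begin

lemma gen_form_F0:
  fixes x y c :: real
  assumes L: "L \<subseteq> A" and T: "T \<subseteq> B" and u: "u \<in> A - L" and t: "t \<in> T"
  defines "h \<equiv> \<lambda>v. if v \<in> B then y else if v \<in> L then 0 else x"
  shows "gen_form c (bip A B (A \<times> B - L \<times> T - {(u, t)})) h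
      = (real (card (A - L)) * card B - 1) * (2 * x * y + c * (x\<^sup>2 + y\<^sup>2)) + real (card L) * card (B - T) * (c * y\<^sup>2)"
    and "(\<Sum>v\<in>A \<union> B. (h v)\<^sup>2) = card (A - L) * x\<^sup>2 + card B * y\<^sup>2"
proof -
  let ?g = "\<lambda>(a, b). 2 * h a * h b + c * ((h a)\<^sup>2 + (h b)\<^sup>2)"
  let ?D1 = "(A - L) \<times> B - {(u, t)}" and ?D2 = "L \<times> (B - T)"
  have tB: "t \<in> B" using t T by blast
  have fin: "finite ?D1" "finite ?D2" using finA finB L by (auto intro: finite_subset)
  have hA: "h a = (if a \<in> L then 0 else x)" if "a \<in> A" for a using that disj by (auto simp: h_def)
  have hB: "h b = y" if "b \<in> B" for b using that by (simp add: h_def)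
  have "gen_form c (bip A B (A \<times> B - L \<times> T - {(u, t)})) h = sum ?g (A \<times> B - L \<times> T - {(u, t)})"
    by (rule gen_form_bip) auto
  also have "sum ?g (A \<times> B - L \<times> T - {(u, t)}) = sum ?g (?D1 \<union> ?D2)"
  proof -
    have "A \<times> B - L \<times> T - {(u, t)} = ?D1 \<union> ?D2" using L T u t by auto
    then show ?thesis by (rule arg_cong)
  qed
  also have "sum ?g (?D1 \<union> ?D2) = sum ?g ?D1 + sum ?g ?D2"
    using fin by (intro sum.union_disjoint) auto
  also have "sum ?g ?D1 = (\<Sum>_\<in>?D1. 2 * x * y + c * (x\<^sup>2 + y\<^sup>2))"
    by (intro sum.cong refl) (auto simp: hA hB)
  also have "sum ?g ?D2 = (\<Sum>_\<in>?D2. c * y\<^sup>2)"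
    using L by (intro sum.cong refl) (auto simp: hA hB subset_iff)
  finally have eq: "gen_form c (bip A B (A \<times> B - L \<times> T - {(u, t)})) h
    = card ?D1 * (2 * x * y + c * (x\<^sup>2 + y\<^sup>2)) + card ?D2 * (c * y\<^sup>2)" by simp
  have "card ?D1 = card (A - L) * card B - 1"
    using u tB by (simp add: card_Diff_singleton card_cartesian_product)
  moreover have "card (A - L) * card B \<ge> 1"
    using u tB finA finB by (metis One_nat_def Suc_leI card_gt_0_iff empty_iff finite_Diff nat_0_less_mult_iff)
  ultimately have "real (card ?D1) = real (card (A - L)) * card B - 1" by (simp add: of_nat_diff)
  then show "gen_form c (bip A B (A \<times> B - L \<times> T - {(u, t)})) h
      = (real (card (A - L)) * card B - 1) * (2 * x * y + c * (x\<^sup>2 + y\<^sup>2)) + real (card L) * card (B - T) * (c * y\<^sup>2)"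
    unfolding eq by (simp add: card_cartesian_product)
  have "(\<Sum>v\<in>A \<union> B. (h v)\<^sup>2) = (\<Sum>a\<in>A. (h a)\<^sup>2) + (\<Sum>b\<in>B. (h b)\<^sup>2)"
    using finA finB disj by (simp add: sum.union_disjoint)
  also have "(\<Sum>a\<in>A. (h a)\<^sup>2) = (\<Sum>a\<in>A - L. x\<^sup>2)"
    by (rule sum.mono_neutral_cong_right) (use finA hA in auto)
  also have "(\<Sum>b\<in>B. (h b)\<^sup>2) = (\<Sum>b\<in>B. y\<^sup>2)" by (intro sum.cong refl) (simp add: hB)
  finally show "(\<Sum>v\<in>A \<union> B. (h v)\<^sup>2) = card (A - L) * x\<^sup>2 + card B * y\<^sup>2" by simp
qed

text \<open>
  The test vector is the Perron vector of the \<open>K\<^bsub>a,n\<^esub>\<close> on \<open>A - L\<close> and \<open>B\<close>, and zero on \<open>L\<close>. The missing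
  edge only lowers its Rayleigh quotient from \<open>\<surd>p\<close> to \<open>(p - 1) / \<surd>p\<close>, where \<open>p = a n\<close>.
\<close>

lemma adj_radius_F0_lower:
  assumes L: "L \<subseteq> A" and T: "T \<subseteq> B" and u: "u \<in> A - L" and t: "t \<in> T"
    and card: "card (A - L) = a" "card B = n"
  defines "\<rho> \<equiv> gen_radius 0 (bip A B (A \<times> B - L \<times> T - {(u, t)}))"
  shows "real a * n - 2 < \<rho>\<^sup>2" "0 \<le> \<rho>"
proof -
  let ?D = "A \<times> B - L \<times> T - {(u, t)}"
  let ?x = "sqrt n" and ?y = "sqrt a"
  define h where "h = (\<lambda>v. if v \<in> B then ?y else if v \<in> L then 0 else ?x)"
  have G: "pair_graph (bip A B ?D)" by (rule pair_graph_bip) auto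
  have ne: "pverts (bip A B ?D) \<noteq> {}" using u by auto
  have "card (A - L) > 0" using u finA by (auto simp: card_gt_0_iff)
  moreover have "card B > 0" using t T finB by (auto simp: card_gt_0_iff)
  ultimately have an: "1 \<le> real a * n" using card
    by (metis One_nat_def Suc_leI nat_0_less_mult_iff of_nat_1 of_nat_le_iff of_nat_mult)
  define p where "p = real a * n"
  have p: "1 \<le> p" using an by (simp add: p_def)
  have xy: "?x * ?y = sqrt p" by (simp add: p_def real_sqrt_mult)
  have "gen_form 0 (bip A B ?D) h \<le> \<rho> * (\<Sum>v\<in>A \<union> B. (h v)\<^sup>2)"
    using gen_form_le_radius[OF G ne, of 0 h] by (simp add: \<rho>_def)
  then have "(p - 1) * (2 * sqrt p) \<le> \<rho> * (2 * p)"
    unfolding h_def gen_form_F0(1)[OF L T u t] gen_form_F0(2)[OF L T u t] card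
    by (simp add: p_def real_sqrt_mult algebra_simps)
  then have le: "(p - 1) * sqrt p \<le> \<rho> * p" by (simp add: algebra_simps)
  have "0 \<le> (p - 1) * sqrt p" using p by simp
  then have "0 \<le> \<rho> * p" using le by linarith
  then show \<rho>: "0 \<le> \<rho>" using p by (simp add: zero_le_mult_iff)
  have "((p - 1) * sqrt p)\<^sup>2 \<le> (\<rho> * p)\<^sup>2"
    using le \<open>0 \<le> (p - 1) * sqrt p\<close> by (rule power_mono)
  moreover have "((p - 1) * sqrt p)\<^sup>2 = (p - 1)\<^sup>2 * p" using p by (simp add: power_mult_distrib)
  moreover have "(\<rho> * p)\<^sup>2 = \<rho>\<^sup>2 * p * p" by (simp add: power2_eq_square)
  ultimately have "(p - 1)\<^sup>2 \<le> \<rho>\<^sup>2 * p" using p by simp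
  moreover have "(p - 2) * p < (p - 1)\<^sup>2" by (simp add: power2_eq_square algebra_simps)
  ultimately have "(p - 2) * p < \<rho>\<^sup>2 * p" by linarith
  then have "p - 2 < \<rho>\<^sup>2" using p by simp
  then show "real a * n - 2 < \<rho>\<^sup>2" by (simp add: p_def)
qed

text \<open>
  The test vector is the Perron vector of the signless Laplacian of the \<open>K\<^bsub>a,n\<^esub>\<close> on \<open>A - L\<close> and \<open>B\<close>, and
  zero on \<open>L\<close>. The missing edge costs \<open>(n + a)\<^sup>2\<close> in the form, and the \<open>r k\<close> edges at \<open>L\<close>, which are
  absent in \<open>K\<^bsub>a,n\<^esub>\<close>, win back \<open>r k a\<^sup>2\<close>. Without this gain the bound would only be \<open>a n - 1 - n / a\<close>,
  which is too weak.
\<close>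

lemma signless_radius_F0_lower:
  assumes L: "L \<subseteq> A" and T: "T \<subseteq> B" and u: "u \<in> A - L" and t: "t \<in> T"
    and card: "card (A - L) = a" "card L = r" "card B = n" "card (B - T) = k"
    and n: "n = a + r" "r > 0" and large: "n + a < k * a\<^sup>2"
  shows "real a * n - 2 < n * (gen_radius 1 (bip A B (A \<times> B - L \<times> T - {(u, t)})) - n)"
proof -
  let ?D = "A \<times> B - L \<times> T - {(u, t)}"
  define \<mu> where "\<mu> = gen_radius 1 (bip A B ?D)"
  define h where "h = (\<lambda>v. if v \<in> B then real a else if v \<in> L then 0 else real n)"
  have G: "pair_graph (bip A B ?D)" by (rule pair_graph_bip) auto
  have ne: "pverts (bip A B ?D) \<noteq> {}" using u by auto
  have "card (A - L) > 0" using u finA by (auto simp: card_gt_0_iff)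
  then have a: "real a > 0" using card by simp
  then have n0: "real n > 0" using n by simp
  have "gen_form 1 (bip A B ?D) h \<le> \<mu> * (\<Sum>v\<in>A \<union> B. (h v)\<^sup>2)"
    using gen_form_le_radius[OF G ne, of 1 h] by (simp add: \<mu>_def)
  then have le: "(real a * n - 1) * (real n + a)\<^sup>2 + r * k * (real a)\<^sup>2 \<le> \<mu> * (a * n * (real n + a))"
    unfolding h_def gen_form_F0(1)[OF L T u t] gen_form_F0(2)[OF L T u t] card
    by (simp add: power2_eq_square algebra_simps)
  have "real r * (real n + a) < r * (k * (real a)\<^sup>2)"
  proof (rule mult_strict_left_mono)
    show "real n + real a < real k * (real a)\<^sup>2"
      using large by (metis of_nat_add of_nat_less_iff of_nat_mult of_nat_power)
  qed (use n in simp)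
  moreover have "real r * (real n + a) = (real n + a)\<^sup>2 - 2 * a * (real n + a)"
    by (simp add: n(1) power2_eq_square algebra_simps)
  ultimately have "(real a * n - 2 + real n * n) * (a * (real n + a)) < n * \<mu> * (a * (real n + a))"
    using le by (simp add: power2_eq_square algebra_simps)
  then have "real a * n - 2 + real n * n < n * \<mu>"
    using a n0 by (simp add: mult_less_cancel_right add_pos_pos)
  then show ?thesis by (simp add: \<mu>_def algebra_simps)
qed

text \<open>
  Both radii of \<open>F\<^sup>0\<close> correspond to more than \<open>a n - 2\<close> edges. The two edges by which this may
  fall short of \<open>a n\<close> are absorbed by \<open>size_estimates\<close>.
\<close>

lemma few_nonedges:
  assumes E: "E \<subseteq> A \<times> B" and card: "card A = n" "card B = n"
    and deg: "\<And>v. v \<in> A \<union> B \<Longrightarrow> k \<le> degree_of (bip A B E) v"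
    and n: "4 * k * (k + 1) \<le> n" and k: "1 \<le> k" and s: "s \<le> k"
    and radius: "gen_radius 0 (F0_graph n k s) \<le> gen_radius 0 (bip A B E)
      \<or> gen_radius 1 (F0_graph n k s) \<le> gen_radius 1 (bip A B E)"
  shows "card (A \<times> B - E) < (n - k - 1) * (k + 2 - s)"
proof -
  define a r where "a = n + s - k - 1" and "r = k + 1 - s"
  note est = size_estimates[OF n k s, folded a_def r_def]
  have r: "r > 0" and r1: "k + 2 - s = r + 1" using s by (auto simp: r_def)
  have n0: "n > 0" using est by simp
  obtain L where L: "L \<subseteq> A" "card L = r" using obtain_subset_with_card_n[of r A] card est by auto
  obtain T where T: "T \<subseteq> B" "card T = n - k" using obtain_subset_with_card_n[of "n - k" B] card by auto
  have cAL: "card (A - L) = a" using L card est finA by (simp add: card_Diff_subset finite_subset)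
  have cBT: "card (B - T) = k" using T card est finB by (simp add: card_Diff_subset finite_subset)
  have "A - L \<noteq> {}" using cAL est(3) by (metis card.empty not_numeral_le_zero)
  moreover have "T \<noteq> {}" using T est by auto
  ultimately obtain u t where u: "u \<in> A - L" and t: "t \<in> T" by blast
  let ?F = "bip A B (A \<times> B - L \<times> T - {(u, t)})"
  have F: "gen_radius c ?F = gen_radius c (F0_graph n k s)" for c
    unfolding F0_graph_def a_def[symmetric] r_def[symmetric]
    by (rule gen_radius_F0_eq) (use card est L T u t in auto)
  have ne: "A \<union> B \<noteq> {}" using u by blast
  have degpos: "degree_of (bip A B E) v > 0" if "v \<in> A \<union> B" for v
    using deg[OF that] k by linarith
  from radius have "real a * n - 2 < card E"
  proof
    assume le: "gen_radius 0 (F0_graph n k s) \<le> gen_radius 0 (bip A B E)"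
    have "real a * n - 2 < (gen_radius 0 ?F)\<^sup>2" by (rule adj_radius_F0_lower(1)[OF L(1) T(1) u t cAL card(2)])
    also have "\<dots> \<le> (gen_radius 0 (bip A B E))\<^sup>2"
      using le adj_radius_F0_lower(2)[OF L(1) T(1) u t cAL card(2)] unfolding F by (rule power_mono)
    also have "\<dots> \<le> card E" by (rule adj_radius_sq_le_edges[OF E ne])
    finally show ?thesis .
  next
    assume le: "gen_radius 1 (F0_graph n k s) \<le> gen_radius 1 (bip A B E)"
    have "real a * n - 2 < n * (gen_radius 1 ?F - n)"
      by (rule signless_radius_F0_lower[OF L(1) T(1) u t cAL L(2) card(2) cBT est(1)[symmetric] r est(5)])
    also have "\<dots> \<le> n * (gen_radius 1 (bip A B E) - n)"
      using le unfolding F by (intro mult_left_mono) auto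
    also have "\<dots> \<le> n * (card E / n)"
      using signless_radius_le_edges[OF E card n0 degpos] by (intro mult_left_mono) auto
    also have "\<dots> = card E" using n0 by simp
    finally show ?thesis .
  qed
  then have "real (a * n) < real (card E + 2)" by simp
  then have edges: "a * n < card E + 2" by (simp only: of_nat_less_iff)
  have "card (A \<times> B - E) = n * n - card E"
    using E finite_edges[OF E] card by (simp add: card_Diff_subset card_cartesian_product)
  moreover have "n * n = a * n + n * r" using est(1) by (metis add_mult_distrib mult.commute)
  ultimately have "card (A \<times> B - E) < n * r + 2" using edges r n0 by auto
  also have "\<dots> \<le> (n - k - 1) * (r + 1)" by (rule est(4))
  finally show ?thesis unfolding r1 .
qed

end

section \<open>Subgraphs of \<open>F\<close> with a large radius\<close>

context two_parts
begin

text \<open>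
  If \<open>E\<close> lacks an edge \<open>(u, t)\<close> with \<open>t \<in> T\<close>, it is properly contained in the copy of \<open>F\<^sup>0\<close> without
  \<open>(u, t)\<close>. Otherwise it lacks some \<open>(u, d)\<close> with \<open>u \<notin> L\<close> and \<open>d \<notin> T\<close>. Compare \<open>d\<close> with any \<open>t \<in> T\<close> under a
  Perron vector \<open>h\<close> of \<open>E\<close>. If \<open>h(t) \<le> h(d)\<close>, replacing the edge \<open>(u, t)\<close> by \<open>(u, d)\<close> does not decrease
  the form and leads into a copy of \<open>F\<^sup>0\<close>. If \<open>h(d) \<le> h(t)\<close>, the edges from \<open>L\<close> to \<open>d\<close> are moved to \<open>t\<close>
  instead; then \<open>d\<close> takes the place of \<open>t\<close> in \<open>T\<close>, and \<open>(u, d)\<close> becomes the additional edge that \<open>F\<^sup>0\<close>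
  lacks. In each case the new graph gives some vertex more neighbours than it has in \<open>E\<close>, namely an
  end of another missing edge, or \<open>d\<close>, or \<open>t\<close>, so \<open>gen_radius_less\<close> applies. The conclusion is about a copy of \<open>F\<^sup>0\<close> whose rectangle may differ from \<open>L \<times> T\<close>.
\<close>

lemma gen_radius_less_F0:
  assumes c: "c \<ge> 0" and L: "L \<subseteq> A" and L0: "L \<noteq> {}" and T: "T \<subseteq> B" and TB: "T \<noteq> B" and T0: "T \<noteq> {}"
    and AL: "card (A - L) \<ge> 2"
    and E: "E \<subseteq> A \<times> B - L \<times> T" and LE: "L \<times> (B - T) \<subseteq> E"
    and notF: "E \<noteq> A \<times> B - L \<times> T"
    and notF0: "\<And>u t. u \<in> A - L \<Longrightarrow> t \<in> T \<Longrightarrow> E \<noteq> A \<times> B - L \<times> T - {(u, t)}"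
  obtains T' u t where "T' \<subseteq> B" "card T' = card T" "u \<in> A - L" "t \<in> T'"
    "gen_radius c (bip A B E) < gen_radius c (bip A B (A \<times> B - L \<times> T' - {(u, t)}))"
proof -
  have EAB: "E \<subseteq> A \<times> B" using E by blast
  have ne: "pverts (bip A B E) \<noteq> {}" using T T0 by auto
  obtain h where h: "gen_eigenvector c (bip A B E) (gen_radius c (bip A B E)) h" "\<And>v. h v \<ge> 0"
    using ex_nonneg_gen_eigenvector[OF pair_graph_bip[OF EAB] ne] by metis
  define D where "D T' u t = A \<times> B - L \<times> T' - {(u, t)}" for T' u t
  have DAB: "D T' u t \<subseteq> A \<times> B" for T' u t by (auto simp: D_def)
  have less: "gen_radius c (bip A B E) < gen_radius c (bip A B (D T' u t))"
    if T': "T' \<subseteq> B" "T' \<noteq> B" "t \<in> T'" and u: "u \<in> A - L"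
      and form: "gen_form c (bip A B E) h \<le> gen_form c (bip A B (D T' u t)) h"
      and z: "z \<in> A \<union> B" "{w. (z, w) \<in> parcs (bip A B E)} \<subset> {w. (z, w) \<in> parcs (bip A B (D T' u t))}"
    for T' u t z
  proof -
    \<comment> \<open>\<open>D T' u t\<close> is connected: \<open>d\<close> is adjacent to all of \<open>A\<close>, and a vertex outside \<open>L\<close> other than \<open>u\<close> to all of \<open>B\<close>\<close>
    obtain d where d: "d \<in> B - T'" using T' by blast
    have "A - L \<noteq> {u}" using AL by auto
    then obtain a where a: "a \<in> A - L" "a \<noteq> u" using u by blast
    have "(a, b) \<in> D T' u t" if "b \<in> B" for b using a that by (auto simp: D_def)
    then have cover: "B \<subseteq> D T' u t `` A" using a by blast
    show ?thesis
      by (rule gen_radius_less[OF c EAB DAB h form _ _ cover z, of d]) (use d T' in \<open>auto simp: D_def\<close>)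
  qed
  show thesis
  proof (cases "\<exists>u\<in>A - L. \<exists>t\<in>T. (u, t) \<notin> E")
    case True
    then obtain u t where ut: "u \<in> A - L" "t \<in> T" "(u, t) \<notin> E" by blast
    have sub: "E \<subseteq> D T u t" using E ut by (auto simp: D_def)
    have "E \<noteq> D T u t" using notF0[OF ut(1,2)] by (simp add: D_def)
    then obtain x y where xy: "(x, y) \<in> D T u t" "(x, y) \<notin> E" using sub by auto
    have x: "x \<in> A" using xy DAB by blast
    have nb: "{w. (x, w) \<in> parcs (bip A B E)} \<subset> {w. (x, w) \<in> parcs (bip A B (D T u t))}"
      unfolding nbrs_left[OF x EAB] nbrs_left[OF x DAB] using sub xy by auto
    have "gen_radius c (bip A B E) < gen_radius c (bip A B (D T u t))"
      by (rule less[OF T TB ut(2,1) gen_form_mono[OF c sub DAB h(2)] _ nb]) (use x in auto)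
    then show thesis using that[OF T refl ut(1,2)] by (simp add: D_def)
  next
    case False
    then have full: "(A - L) \<times> T \<subseteq> E" by auto
    obtain u d where ud: "u \<in> A" "d \<in> B" "(u, d) \<notin> E" "(u, d) \<notin> L \<times> T"
      using notF E by blast
    have d: "d \<in> B - T" and u: "u \<in> A - L" using ud full LE by auto
    obtain t where t: "t \<in> T" using T0 by blast
    have ut: "(u, t) \<in> E" using full u t by blast
    have tB: "t \<in> B" using t T by blast
    have dt: "d \<noteq> t" using d t by auto
    define g where "g a b = 2 * h a * h b + c * ((h a)\<^sup>2 + (h b)\<^sup>2)" for a b
    have g_mono: "g a b \<le> g a b'" if "h b \<le> h b'" for a b b'
      unfolding g_def using that c h(2)
      by (intro add_mono mult_left_mono power_mono) auto
    have finE: "finite E" by (rule finite_edges[OF EAB])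
    have formE: "gen_form c (bip A B E') h = (\<Sum>(a, b)\<in>E'. g a b)" if "E' \<subseteq> A \<times> B" for E'
      using gen_form_bip[OF that, of c h] by (simp add: g_def)
    show thesis
    proof (cases "h t \<le> h d")
      case True
      let ?E = "insert (u, d) (E - {(u, t)})"
      have EB: "?E \<subseteq> A \<times> B" using EAB ud by auto
      have sub: "?E \<subseteq> D T u t" using E u d dt by (auto simp: D_def)
      have "(\<Sum>(a, b)\<in>E. g a b) \<le> (\<Sum>(a, b)\<in>?E. g a b)"
        using finE ud(3) ut g_mono[OF True, of u] by (simp add: sum_diff1)
      then have "gen_form c (bip A B E) h \<le> gen_form c (bip A B ?E) h"
        unfolding formE[OF EAB] formE[OF EB] .
      also have "\<dots> \<le> gen_form c (bip A B (D T u t)) h" by (rule gen_form_mono[OF c sub DAB h(2)])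
      finally have form: "gen_form c (bip A B E) h \<le> gen_form c (bip A B (D T u t)) h" .
      have nb: "{w. (d, w) \<in> parcs (bip A B E)} \<subset> {w. (d, w) \<in> parcs (bip A B (D T u t))}"
        unfolding nbrs_right[OF ud(2) EAB] nbrs_right[OF ud(2) DAB] using EAB d ud dt by (auto simp: D_def)
      have "gen_radius c (bip A B E) < gen_radius c (bip A B (D T u t))"
        by (rule less[OF T TB t u form _ nb]) (use d in auto)
      then show thesis using that[OF T refl u t] by (simp add: D_def)
    next
      case False
      then have le: "h d \<le> h t" by simp
      define T' where "T' = insert d (T - {t})"
      have T': "T' \<subseteq> B" "d \<in> T'" "t \<notin> T'" using T d dt by (auto simp: T'_def)
      have cardT': "card T' = card T"
        proof -
      have fT: "finite T" using T finB by (rule finite_subset)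
      then have "card T' = Suc (card (T - {t}))" using d by (simp add: T'_def)
      also have "\<dots> = card T" by (rule card.remove[OF fT t, symmetric])
      finally show ?thesis .
    qed
      let ?E = "(E - L \<times> {d}) \<union> L \<times> {t}"
      have EB: "?E \<subseteq> A \<times> B" using EAB L tB by auto
      have sub: "?E \<subseteq> D T' u d" using E u d dt ud L tB by (auto simp: D_def T'_def)
      have finL: "finite L" using L finA finite_subset by blast
      have Ld: "L \<times> {d} \<subseteq> E" using LE d by blast
      have "(\<Sum>(a, b)\<in>E. g a b) = (\<Sum>(a, b)\<in>E - L \<times> {d}. g a b) + (\<Sum>(a, b)\<in>L \<times> {d}. g a b)"
        by (rule sum.subset_diff[OF Ld finE])
      also have "(\<Sum>(a, b)\<in>L \<times> {d}. g a b) = (\<Sum>a\<in>L. g a d)"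
        by (simp flip: sum.cartesian_product)
      also have "\<dots> \<le> (\<Sum>a\<in>L. g a t)" by (intro sum_mono g_mono le)
      also have "\<dots> = (\<Sum>(a, b)\<in>L \<times> {t}. g a b)" by (simp flip: sum.cartesian_product)
      also have "(\<Sum>(a, b)\<in>E - L \<times> {d}. g a b) + \<dots> = (\<Sum>(a, b)\<in>?E. g a b)"
        using finE finL E t by (intro sum.union_disjoint[symmetric]) auto
      finally have "gen_form c (bip A B E) h \<le> gen_form c (bip A B ?E) h"
        unfolding formE[OF EAB] formE[OF EB] by simp
      also have "\<dots> \<le> gen_form c (bip A B (D T' u d)) h" by (rule gen_form_mono[OF c sub DAB h(2)])
      finally have form: "gen_form c (bip A B E) h \<le> gen_form c (bip A B (D T' u d)) h" .
      have nb: "{w. (t, w) \<in> parcs (bip A B E)} \<subset> {w. (t, w) \<in> parcs (bip A B (D T' u d))}"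
        unfolding nbrs_right[OF tB EAB] nbrs_right[OF tB DAB] using E L t tB T' dt L0 by (auto simp: D_def)
      have "gen_radius c (bip A B E) < gen_radius c (bip A B (D T' u d))"
        by (rule less[OF T'(1) _ T'(2) u form _ nb]) (use T' tB in auto)
      then show thesis using that[OF T'(1) cardT' u T'(2)] by (simp add: D_def)
    qed
  qed
qed

text \<open>
  A vertex of \<open>L\<close> has no neighbours in \<open>T\<close>, and \<open>B - T\<close> has only \<open>k\<close> vertices; so the minimum degree
  makes it adjacent to all of \<open>B - T\<close>, as \<open>gen_radius_less_F0\<close> requires.
\<close>

lemma extremal_subgraph:
  assumes E: "E \<subseteq> A \<times> B" and card: "card A = n" "card B = n"
    and deg: "\<And>v. v \<in> A \<union> B \<Longrightarrow> k \<le> degree_of (bip A B E) v"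
    and n: "4 * k * (k + 1) \<le> n" and k: "1 \<le> k" and s: "s \<le> k"
    and L: "L \<subseteq> A" "card L = k + 1 - s" and T: "T \<subseteq> B" "card T = n - k" and LT: "E \<inter> L \<times> T = {}"
    and c: "c \<ge> 0" and radius: "gen_radius c (F0_graph n k s) \<le> gen_radius c (bip A B E)"
  shows "digraph_iso (with_proj (bip A B E)) (with_proj (F_graph n k s))
    \<or> digraph_iso (with_proj (bip A B E)) (with_proj (F0_graph n k s))"
proof (rule ccontr)
  assume contr: "\<not> ?thesis"
  define a r where "a = n + s - k - 1" and "r = k + 1 - s"
  note est = size_estimates[OF n k s, folded a_def r_def]
  have r: "r > 0" using s by (simp add: r_def)
  have Lr: "card L = r" using L by (simp add: r_def)
  have cAL: "card (A - L) = a" using L(1) Lr card est finA by (simp add: card_Diff_subset finite_subset)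
  have cBT: "card (B - T) = k" using T card est finB by (simp add: card_Diff_subset finite_subset)
  have G: "pair_graph (bip A B E)" by (rule pair_graph_bip[OF E])
  have AL: "A - L \<noteq> {}" using cAL est(3) by (metis card.empty not_numeral_le_zero)
  have T0: "T \<noteq> {}" using T est by auto
  note iso = Z_graph_iso[OF card(2) _ L(1) Lr T, of a]
  have cardA: "card A = a + r" "a > 0" using card est by auto
  have LE: "L \<times> (B - T) \<subseteq> E"
  proof (intro subsetI, clarify)
    fix l b assume l: "l \<in> L" and b: "b \<in> B" "b \<notin> T"
    have lA: "l \<in> A" using l L by blast
    have "E `` {l} \<subseteq> B - T" using E LT l by auto
    moreover have "card (B - T) \<le> card (E `` {l})"
      using deg[of l] lA cBT by (simp add: degree_bip_left[OF lA E])
    ultimately have "E `` {l} = B - T" using finB by (metis card_seteq finite_Diff)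
    then show "(l, b) \<in> E" using b by auto
  qed
  have notF: "E \<noteq> A \<times> B - L \<times> T"
  proof
    assume eq: "E = A \<times> B - L \<times> T"
    obtain u t where "u \<in> A - L" "t \<in> T" using AL T0 by blast
    then obtain g where "graph_map g (bip A B E) (F_graph n k s)"
      using iso[OF cardA(1) _ _ cardA(2) est(2)] unfolding eq F_graph_def a_def[symmetric] r_def[symmetric] by metis
    then show False
      using contr graph_map_digraph_iso[OF G] pair_graph_Z unfolding F_graph_def by blast
  qed
  have notF0: "E \<noteq> A \<times> B - L \<times> T - {(u, t)}" if ut: "u \<in> A - L" "t \<in> T" for u t
  proof
    assume eq: "E = A \<times> B - L \<times> T - {(u, t)}"
    obtain g where "graph_map g (bip A B E) (F0_graph n k s)"
      using iso[OF cardA(1) ut cardA(2) est(2)] unfolding eq F0_graph_def a_def[symmetric] r_def[symmetric] by metis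
    then show False
      using contr graph_map_digraph_iso[OF G] pair_graph_Z0 unfolding F0_graph_def by blast
  qed
  have "L \<noteq> {}" "T \<noteq> B" using Lr r cBT k by auto
  then obtain T' u t where T': "T' \<subseteq> B" "card T' = card T" "u \<in> A - L" "t \<in> T'"
    and less: "gen_radius c (bip A B E) < gen_radius c (bip A B (A \<times> B - L \<times> T' - {(u, t)}))"
    using gen_radius_less_F0[OF c L(1) _ T(1) _ T0 _ _ LE notF notF0] E LT cAL est(3) by blast
  have "gen_radius c (bip A B (A \<times> B - L \<times> T' - {(u, t)})) = gen_radius c (F0_graph n k s)"
    unfolding F0_graph_def a_def[symmetric] r_def[symmetric]
    by (rule gen_radius_F0_eq) (use card cardA est L(1) Lr T T' in auto)
  then show False using less radius by simp
qed

end

section \<open>The closure of a graph with a large radius\<close>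

context two_parts
begin

lemma card_nonneighbours:
  assumes E: "E \<subseteq> A \<times> B"
  shows "a \<in> A \<Longrightarrow> card ((A \<times> B - E) `` {a}) = card B - degree_of (bip A B E) a"
    and "b \<in> B \<Longrightarrow> card ((A \<times> B - E)\<inverse> `` {b}) = card A - degree_of (bip A B E) b"
proof -
  assume a: "a \<in> A"
  have "(A \<times> B - E) `` {a} = B - E `` {a}" using a by auto
  then show "card ((A \<times> B - E) `` {a}) = card B - degree_of (bip A B E) a"
    using E finB by (simp add: degree_bip_left[OF a E] card_Diff_subset finite_subset[of _ B] Image_subset)
next
  assume b: "b \<in> B"
  have "(A \<times> B - E)\<inverse> `` {b} = A - E\<inverse> `` {b}" using b by auto
  moreover have "E\<inverse> `` {b} \<subseteq> A" using E by auto
  ultimately show "card ((A \<times> B - E)\<inverse> `` {b}) = card A - degree_of (bip A B E) b"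
    using finA by (simp add: degree_bip_right[OF b E] card_Diff_subset finite_subset)
qed

end

lemma bip_swap: "bip A B E = bip B A (E\<inverse>)"
  by (auto simp: bip_def)

theorem theorem1p14:
  fixes G :: "'a pair_pre_digraph" and U V :: "'a set" and n k s :: nat
  assumes "bipartite_graph U V G"
    and "card U = card V"
    and "card (pverts G) = 2 * n"
    and "2 * n \<ge> 8 * k * (k + 1)"
    and "min_degree G \<ge> k"
    and "k \<ge> max s 1"
    and "rho G \<ge> rho (F0_graph n k s) \<or> mu G \<ge> mu (F0_graph n k s)"
  shows "K\<^bsub>n,n\<^esub> (with_proj (bipartite_closure U V (n + s) G))
    \<or> digraph_iso (with_proj G) (with_proj (F_graph n k s))
    \<or> digraph_iso (with_proj G) (with_proj (F0_graph n k s))"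
proof -
  interpret G: pair_graph G using assms(1) by (simp add: bipartite_graph_def)
  have UV: "pverts G = U \<union> V" "U \<inter> V = {}" using assms(1) by (auto simp: bipartite_graph_def)
  have fin: "finite U" "finite V" using G.pair_finite_verts UV by auto
  interpret two_parts U V by unfold_locales (use fin UV in auto)
  have card: "card U = n" "card V = n"
    using assms(2,3) card_Un_disjoint[OF fin UV(2)] UV(1) by auto
  have n: "4 * k * (k + 1) \<le> n" and k: "1 \<le> k" and s: "s \<le> k" using assms(4,6) by auto
  note est = size_estimates[OF n k s]
  define E where "E = parcs G \<inter> U \<times> V"
  have E: "E \<subseteq> U \<times> V" by (simp add: E_def)
  have G_bip: "G = bip U V E" unfolding E_def by (rule bipartite_graph_eq_bip[OF assms(1)])
  have deg: "k \<le> degree_of (bip U V E) v" if "v \<in> U \<union> V" for v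
  proof -
    have "min_degree G \<le> degree_of G v"
      unfolding min_degree_def using G.pair_finite_verts UV that by (intro Min_le) auto
    then show ?thesis using assms(5) by (simp flip: G_bip)
  qed
  have radius: "gen_radius 0 (F0_graph n k s) \<le> gen_radius 0 (bip U V E)
      \<or> gen_radius 1 (F0_graph n k s) \<le> gen_radius 1 (bip U V E)"
    using assms(7) rho_eq_gen_radius[OF G.pair_graph_axioms] mu_eq_gen_radius[OF G.pair_graph_axioms]
      rho_eq_gen_radius[OF pair_graph_Z0] mu_eq_gen_radius[OF pair_graph_Z0]
    unfolding F0_graph_def by (simp flip: G_bip)
  have few: "card (U \<times> V - E) < (n - k - 1) * (k + 2 - s)"
    by (rule few_nonedges[OF E card deg n k s radius])
  obtain c :: real where c: "c \<ge> 0" and radius_c: "gen_radius c (F0_graph n k s) \<le> gen_radius c (bip U V E)"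
    using radius by (metis order_refl zero_le_one)
  define H where "H = bipartite_closure U V (n + s) G"
  have clos: "is_bipartite_closure U V (n + s) G H"
    unfolding H_def bipartite_closure_def by (rule theI'[OF ex1_bipartite_closure[OF assms(1)]])
  then have H: "bipartite_graph U V H" and sub: "parcs G \<subseteq> parcs H"
    using closure_steps_invariant[OF _ assms(1)] by (auto simp: is_bipartite_closure_def)
  define D where "D = parcs H \<inter> U \<times> V"
  have D: "D \<subseteq> U \<times> V" by (simp add: D_def)
  have H_bip: "H = bip U V D" unfolding D_def by (rule bipartite_graph_eq_bip[OF H])
  have ED: "E \<subseteq> D" using sub by (auto simp: E_def D_def)
  show ?thesis
  proof (cases "D = U \<times> V")
    case True
    have "K\<^bsub>n,n\<^esub> (with_proj H)"
      unfolding complete_bipartite_digraph_pair_def H_bip True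
      using fin UV card by (intro conjI exI[of _ U] exI[of _ V]) auto
    then show ?thesis by (simp add: H_def)
  next
    case False
    define N where "N = U \<times> V - D"
    have N0: "N \<noteq> {}" and finN: "finite N" using False D fin by (auto simp: N_def)
    have degD: "k \<le> degree_of H v" if "v \<in> U \<union> V" for v
    proof -
      have "degree_of (bip U V E) v \<le> degree_of (bip U V D) v"
        unfolding degree_of_eq_card
        by (rule card_mono) (use ED D fin in \<open>auto intro: finite_subset[of _ "U \<union> V"]\<close>)
      then show ?thesis using deg[OF that] H_bip by simp
    qed
    have not_step: "degree_of H u + degree_of H v < n + s" if "(u, v) \<in> N" for u v
    proof -
      have "u \<in> U" "v \<in> V" "(u, v) \<notin> parcs H" using that by (auto simp: N_def D_def)
      then have "closure_step U V (n + s) H (add_edge u v H)" if "n + s \<le> degree_of H u + degree_of H v"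
        using that unfolding closure_step_def by blast
      then show ?thesis using clos unfolding is_bipartite_closure_def by (meson not_less)
    qed
    have row: "card (N `` {u}) = n - degree_of H u" if "u \<in> U" for u
      using card_nonneighbours(1)[OF D that] card by (simp add: N_def H_bip)
    have col: "card (N\<inverse> `` {v}) = n - degree_of H v" if "v \<in> V" for v
      using card_nonneighbours(2)[OF D that] card by (simp add: N_def H_bip)
    have mem: "u \<in> U" "v \<in> V" if "(u, v) \<in> N" for u v using that by (auto simp: N_def)
    have "card N \<le> card (U \<times> V - E)"
      unfolding N_def using ED fin by (intro card_mono) auto
    also note few
    also have "k + 2 - s = (k + 1 - s) + 1" using s by simp
    finally have small: "card N < (n - k - 1) * ((k + 1 - s) + 1)" .
    have EN: "E \<inter> N = {}" using ED by (auto simp: N_def)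
    have sum: "n - k + (k + 1 - s) \<le> card (N `` {u}) + card (N\<inverse> `` {v})" if "(u, v) \<in> N" for u v
      using not_step[OF that] s est(2) by (simp add: row[OF mem(1)[OF that]] col[OF mem(2)[OF that]])
    have le: "card (N `` {u}) \<le> n - k" "card (N\<inverse> `` {v}) \<le> n - k" if "(u, v) \<in> N" for u v
      using degD mem[OF that] by (simp_all add: row col diff_le_mono2)
    consider L T where "N = L \<times> T" "card L = k + 1 - s" "card T = n - k"
      | L T where "N = L \<times> T" "card L = n - k" "card T = k + 1 - s"
      by (rule nonedges_rectangle[OF finN N0 le sum small])
    then have "digraph_iso (with_proj (bip U V E)) (with_proj (F_graph n k s))
      \<or> digraph_iso (with_proj (bip U V E)) (with_proj (F0_graph n k s))"
    proof cases
      case (1 L T)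
      have "L \<noteq> {}" "T \<noteq> {}" using 1 N0 by auto
      then have "L \<subseteq> U" "T \<subseteq> V" using 1(1) by (auto simp: N_def)
      then show ?thesis
        using 1 EN by (intro extremal_subgraph[OF E card deg n k s _ _ _ _ _ c radius_c]) auto
    next
      case (2 L T)
      have "L \<noteq> {}" "T \<noteq> {}" using 2 N0 by auto
      then have LT: "L \<subseteq> U" "T \<subseteq> V" using 2(1) by (auto simp: N_def)
      \<comment> \<open>the rectangle has its short side in \<open>V\<close>, so the two sides change their roles\<close>
      interpret swap: two_parts V U by unfold_locales (use fin UV in auto)
      have E': "E\<inverse> \<subseteq> V \<times> U" using E by auto
      have disj: "E\<inverse> \<inter> T \<times> L = {}" using 2 EN by auto
      show ?thesis
        unfolding bip_swap[of U V E]
        by (rule swap.extremal_subgraph[OF E' card(2,1) _ n k s LT(2) 2(3) LT(1) 2(2) disj c])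
           (use deg radius_c in \<open>auto simp: bip_swap[of U V E] simp del: bip_simps\<close>)
    qed
    then show ?thesis by (simp flip: G_bip)
  qed
qed

end
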